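(* Let $k \geq 6$ and $r \geq 3$ be integers. Every graph $G$ with average degree at least $\tfrac{4}{3}kr$ contains $k$ pairwise vertex-disjoint cycles, each containing at least $r$ vertices.
   Context: Graphs are finite and simple. The average degree of a graph $G$ is $d(G) = 2|E(G)|/|V(G)|$. *)

theory Defs
  imports Complex_Main "HOL-Library.Disjoint_Sets" "Graph_Theory.Graph_Theory"
begin

text \<open>
  A finite simple graph is a \<^locale>\<open>pair_graph\<close>: a finite vertex set with a finite, symmetric,
  irreflexive set of arcs on it. An edge is thus represented by two opposite arcs, and
  \<open>edges\<close> recovers the set of undirected edges, so that each edge is counted once.
\<close>

definition edges :: "'a pair_pre_digraph \<Rightarrow> 'a set set" where
  "edges G = {{u, v} | u v. (u, v) \<in> parcs G}"

text \<open>Equal to 0 for the graph without vertices, as division by zero yields 0.\<close>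

definition average_degree :: "'a pair_pre_digraph \<Rightarrow> real" where
  "average_degree G = 2 * real (card (edges G)) / real (card (pverts G))"

text \<open>
  The closed walk that traverses one edge back and forth satisfies \<^const>\<open>pre_digraph.cycle\<close>.
  It is not a cycle of an undirected graph, hence the bound on the length.
\<close>

definition graph_cycle :: "'a pair_pre_digraph \<Rightarrow> ('a \<times> 'a) awalk \<Rightarrow> bool" where
  "graph_cycle G p \<longleftrightarrow> pre_digraph.cycle (with_proj G) p \<and> 3 \<le> length p"

definition cycle_verts :: "('a \<times> 'a) awalk \<Rightarrow> 'a set" where
  "cycle_verts p = set (pawalk_verts (fst (hd p)) p)"

end

theory Submission
  imports Defs
begin

text \<open>
  Call a graph with \<open>n\<close> vertices dense if it has at least \<open>b r n\<close> edges, where \<open>b = 2k/3\<close>. The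
  argument is an induction on \<open>k\<close>: remove a cycle on exactly \<open>r\<close> vertices that meets few edges.

  Disjoint long cycles lift from a minor to the graph, so by contracting and deleting one may assume
  that every edge lies in about \<open>b r\<close> triangles and that there are hardly more than \<open>b r n\<close> edges.
  Then many vertices have low degree, and double counting the edges inside their neighbourhoods yields
  a low vertex \<open>v\<close> whose neighbourhood contains a path of edges each having many low common
  neighbours. Subdivide these edges by low vertices, prolong the path greedily inside the
  neighbourhood of \<open>v\<close>, and close it through \<open>v\<close>. The resulting cycle has \<open>r\<close> vertices, at least
  \<open>c r\<close> of them low, and deleting it leaves at least \<open>(b - 1 + c) r\<close> edges per vertex. With \<open>c = 1/3\<close>
  this lowers \<open>b\<close> by \<open>2/3\<close>.

  For small \<open>k\<close> the choice \<open>c = 1/3\<close> fails when \<open>r \<ge> 4\<close>; there \<open>c\<close> varies, and the intermediate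
  values of \<open>b\<close> exceed \<open>2k/3\<close> slightly. They reach it at \<open>k = 6\<close>, where the hypothesis on \<open>k\<close> enters.
  The induction starts at \<open>k = 1\<close> with a rotation argument on longest paths.
\<close>

section \<open>Paths and cycles\<close>

abbreviation walk :: "('a \<times> 'a) set \<Rightarrow> 'a list \<Rightarrow> bool" where
  "walk A \<equiv> successively (\<lambda>x y. (x, y) \<in> A)"

text \<open>Both orientations of an edge lie in \<open>A\<close>, so \<open>card A\<close> is twice
  the number of edges. This is the source of the factor 2 in density bounds such as
  \<open>2 * B * card V \<le> card A\<close>.\<close>

definition sgraph :: "'a set \<Rightarrow> ('a \<times> 'a) set \<Rightarrow> bool" where
  "sgraph V A \<longleftrightarrow> finite V \<and> A \<subseteq> V \<times> V \<and> sym A \<and> irrefl A"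

text \<open>The first vertex is not repeated at the end, so \<open>length xs\<close> is the number
  of vertices of the cycle.\<close>

definition is_cyc :: "('a \<times> 'a) set \<Rightarrow> 'a list \<Rightarrow> bool" where
  "is_cyc A xs \<longleftrightarrow> distinct xs \<and> 3 \<le> length xs \<and> walk A xs \<and> (last xs, hd xs) \<in> A"

definition has_long_cycles :: "('a \<times> 'a) set \<Rightarrow> nat \<Rightarrow> nat \<Rightarrow> bool" where
  "has_long_cycles A r k \<longleftrightarrow> (\<exists>C :: nat \<Rightarrow> 'a list.
     (\<forall>i<k. is_cyc A (C i) \<and> r \<le> length (C i)) \<and> disjoint_family_on (\<lambda>i. set (C i)) {..<k})"

lemma sgraph_finite: "sgraph V A \<Longrightarrow> finite V"
  by (simp add: sgraph_def)

lemma sgraph_finite_arcs: "sgraph V A \<Longrightarrow> finite A"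
  unfolding sgraph_def using finite_subset[of A "V \<times> V"] by blast

lemma sgraph_sym: "sgraph V A \<Longrightarrow> (x, y) \<in> A \<Longrightarrow> (y, x) \<in> A"
  by (auto simp: sgraph_def dest: symD)

lemma sgraph_irrefl: "sgraph V A \<Longrightarrow> (x, x) \<notin> A"
  by (auto simp: sgraph_def irrefl_def)

lemma sgraph_arcD: "sgraph V A \<Longrightarrow> (x, y) \<in> A \<Longrightarrow> x \<in> V \<and> y \<in> V"
  by (auto simp: sgraph_def)

lemma sgraph_nbrs: "sgraph V A \<Longrightarrow> A `` {v} \<subseteq> V"
  by (auto simp: sgraph_def)

lemma sgraph_finite_nbrs: "sgraph V A \<Longrightarrow> finite (A `` {v})"
  by (meson finite_subset sgraph_finite sgraph_nbrs)

lemma card_eq_sum_Image: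
  assumes "finite W" "A \<subseteq> W \<times> W"
  shows "card A = (\<Sum>v\<in>W. card (A `` {v}))"
proof -
  have "A = (SIGMA v:W. A `` {v})" using assms by auto
  moreover have "\<forall>v\<in>W. finite (A `` {v})"
    using assms by (auto intro: finite_subset[of _ W])
  ultimately show ?thesis using card_SigmaI[OF assms(1)] by metis
qed

lemma sgraph_restrict: "sgraph V A \<Longrightarrow> W \<subseteq> V \<Longrightarrow> sgraph W (A \<inter> W \<times> W)"
  by (auto simp: sgraph_def sym_def irrefl_def intro: finite_subset)

lemma walk_mono: "walk A xs \<Longrightarrow> A \<subseteq> B \<Longrightarrow> walk B xs"
  by (erule successively_mono) auto

lemma is_cyc_mono: "is_cyc A xs \<Longrightarrow> A \<subseteq> B \<Longrightarrow> is_cyc B xs"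
  unfolding is_cyc_def using walk_mono by blast

lemma walk_rev:
  assumes "sym A" "walk A xs"
  shows "walk A (rev xs)"
  unfolding successively_rev using assms(2)
  by (rule successively_mono) (use assms(1) in \<open>blast dest: symD\<close>)

lemma walk_subset:
  "walk A xs \<Longrightarrow> A \<subseteq> V \<times> V \<Longrightarrow> 2 \<le> length xs \<Longrightarrow> set xs \<subseteq> V"
proof (induction xs rule: induct_list012)
  case (3 x y zs)
  then show ?case by (cases zs) (auto)
qed auto

lemma is_cyc_subset: "is_cyc A xs \<Longrightarrow> A \<subseteq> V \<times> V \<Longrightarrow> set xs \<subseteq> V"
  using walk_subset[of A xs V] by (auto simp: is_cyc_def)

lemma has_long_cycles_mono:
  "has_long_cycles A r k \<Longrightarrow> A \<subseteq> B \<Longrightarrow> has_long_cycles B r k"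
  unfolding has_long_cycles_def using is_cyc_mono by meson

lemma is_cyc_rotate:
  assumes "is_cyc A (xs @ ys)"
  shows "is_cyc A (ys @ xs)"
  using assms
  by (cases "xs = []"; cases "ys = []") (auto simp: is_cyc_def successively_append_iff)

lemma has_long_cycles_Suc:
  assumes "is_cyc A xs" "r \<le> length xs"
    and "has_long_cycles (A \<inter> (V - set xs) \<times> (V - set xs)) r k"
  shows "has_long_cycles A r (Suc k)"
proof -
  let ?A' = "A \<inter> (V - set xs) \<times> (V - set xs)"
  obtain C where C: "\<And>i. i < k \<Longrightarrow> is_cyc ?A' (C i) \<and> r \<le> length (C i)"
    "disjoint_family_on (\<lambda>i. set (C i)) {..<k}"
    using assms(3) unfolding has_long_cycles_def by blast
  have sub: "set (C i) \<subseteq> V - set xs" if "i < k" for i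
    using C(1)[OF that] is_cyc_subset[of ?A' "C i" "V - set xs"] by auto
  define C' where "C' = C(k := xs)"
  have "\<forall>i<Suc k. is_cyc A (C' i) \<and> r \<le> length (C' i)"
    using C(1) assms(1,2) is_cyc_mono[of ?A' _ A] by (auto simp: C'_def less_Suc_eq)
  moreover have "disjoint_family_on (\<lambda>i. set (C' i)) {..<Suc k}"
    unfolding disjoint_family_on_def
  proof (intro ballI impI)
    fix i j assume "i \<in> {..<Suc k}" "j \<in> {..<Suc k}" "i \<noteq> j"
    then consider "i < k" "j < k" | "i = k" "j < k" | "i < k" "j = k" by force
    then show "set (C' i) \<inter> set (C' j) = {}"
    proof cases
      case 1
      then show ?thesis using disjoint_family_onD[OF C(2), of i j] \<open>i \<noteq> j\<close> by (simp add: C'_def)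
    next
      case 2
      then show ?thesis using sub[of j] by (auto simp: C'_def)
    next
      case 3
      then show ?thesis using sub[of i] by (auto simp: C'_def)
    qed
  qed
  ultimately show ?thesis unfolding has_long_cycles_def by blast
qed

section \<open>Subsets of large minimum degree, greedy paths and subdivisions\<close>

text \<open>Deleting a vertex with at most \<open>c\<close> neighbours destroys at most
  \<open>2 * c\<close> arcs, so the hypothesis survives the deletion. It fails for the empty set,
  hence the deletions stop at a nonempty set.\<close>

lemma min_degree_subset:
  assumes "finite W" "sym R" "2 * c * card W < card (R \<inter> W \<times> W)"
  shows "\<exists>U\<subseteq>W. U \<noteq> {} \<and> (\<forall>x\<in>U. c < card (R `` {x} \<inter> U))"
  using assms
proof (induction "card W" arbitrary: W rule: less_induct)
  case less
  show ?case
  proof (cases "\<forall>x\<in>W. c < card (R `` {x} \<inter> W)")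
    case True
    have "W \<noteq> {}" using less.prems(3) by fastforce
    then show ?thesis using True by (intro exI[of _ W]) simp
  next
    case False
    then obtain x where x: "x \<in> W" "card (R `` {x} \<inter> W) \<le> c" by (meson not_less)
    let ?W = "W - {x}" and ?N = "R `` {x} \<inter> W"
    have fin: "finite ?N" using less.prems(1) by simp
    have "R \<inter> W \<times> W \<subseteq> (R \<inter> ?W \<times> ?W) \<union> ({x} \<times> ?N \<union> ?N \<times> {x})"
    proof
      fix p assume "p \<in> R \<inter> W \<times> W"
      then obtain a b where p: "p = (a, b)" "(a, b) \<in> R" "a \<in> W" "b \<in> W" by blast
      have "(b, a) \<in> R" using symD[OF \<open>sym R\<close> p(2)] .
      then show "p \<in> (R \<inter> ?W \<times> ?W) \<union> ({x} \<times> ?N \<union> ?N \<times> {x})"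
        using p by (cases "a = x"; cases "b = x") simp_all
    qed
    moreover have "finite ((R \<inter> ?W \<times> ?W) \<union> ({x} \<times> ?N \<union> ?N \<times> {x}))"
      using less.prems(1) fin by simp
    ultimately have "card (R \<inter> W \<times> W) \<le> card ((R \<inter> ?W \<times> ?W) \<union> ({x} \<times> ?N \<union> ?N \<times> {x}))"
      by (rule card_mono[rotated])
    also have "\<dots> \<le> card (R \<inter> ?W \<times> ?W) + (card ({x} \<times> ?N) + card (?N \<times> {x}))"
      using card_Un_le[of "R \<inter> ?W \<times> ?W" "{x} \<times> ?N \<union> ?N \<times> {x}"] card_Un_le[of "{x} \<times> ?N" "?N \<times> {x}"]
      by linarith
    also have "\<dots> \<le> card (R \<inter> ?W \<times> ?W) + 2 * c"
      using x(2) unfolding card_cartesian_product by simp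
    finally have "card (R \<inter> W \<times> W) \<le> card (R \<inter> ?W \<times> ?W) + 2 * c" .
    moreover have cW: "card W = Suc (card ?W)" using card_Suc_Diff1[OF less.prems(1) x(1)] by (rule sym)
    moreover have "2 * c * card W = 2 * c * card ?W + 2 * c"
      unfolding cW by (simp only: mult_Suc_right)
    ultimately have "2 * c * card ?W < card (R \<inter> ?W \<times> ?W)" using less.prems(3) by linarith
    moreover have "card ?W < card W" using cW by linarith
    ultimately have "\<exists>U\<subseteq>?W. U \<noteq> {} \<and> (\<forall>x\<in>U. c < card (R `` {x} \<inter> U))"
      using less.hyps[of ?W] less.prems(1,2) by blast
    then show ?thesis by blast
  qed
qed

text \<open>The path grows at its head. The head has at least \<open>m - 1\<close> neighbours in
  \<open>U\<close>, and the other vertices of a path with fewer than \<open>m\<close> vertices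
  cannot cover them all. Apart from the head, the vertices of \<open>xs\<close> may lie outside
  \<open>U\<close>.\<close>

lemma extend_path:
  assumes deg: "\<And>x. x \<in> U \<Longrightarrow> m \<le> card (R `` {x} \<inter> U) + 1"
    and "finite U" "sym R" "irrefl R"
    and "distinct xs" "walk R xs" "xs \<noteq> []" "hd xs \<in> U" "length xs \<le> m"
  shows "\<exists>ys. distinct (ys @ xs) \<and> walk R (ys @ xs) \<and> hd (ys @ xs) \<in> U \<and> set ys \<subseteq> U
    \<and> length (ys @ xs) = m"
  using assms(5-)
proof (induction "m - length xs" arbitrary: xs)
  case 0
  then show ?case by (intro exI[of _ "[]"]) auto
next
  case (Suc d)
  obtain x xs' where xs: "xs = x # xs'" using Suc.prems by (cases xs) auto
  have "\<not> R `` {x} \<inter> U \<subseteq> set xs'"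
  proof
    assume "R `` {x} \<inter> U \<subseteq> set xs'"
    then have "card (R `` {x} \<inter> U) \<le> length xs'"
      by (meson List.finite_set card_length card_mono le_trans)
    then show False using deg[of x] Suc xs by auto
  qed
  then obtain y where y: "(x, y) \<in> R" "y \<in> U" "y \<notin> set xs'" by auto
  have "y \<noteq> x" using y(1) \<open>irrefl R\<close> by (auto simp: irrefl_def)
  have "\<exists>ys. distinct (ys @ (y # xs)) \<and> walk R (ys @ (y # xs)) \<and> hd (ys @ (y # xs)) \<in> U
      \<and> set ys \<subseteq> U \<and> length (ys @ (y # xs)) = m"
    using Suc.prems Suc.hyps(2) y \<open>y \<noteq> x\<close> symD[OF \<open>sym R\<close> y(1)]
    by (intro Suc.hyps(1)) (auto simp: xs)
  then obtain ys where "distinct (ys @ (y # xs)) \<and> walk R (ys @ (y # xs)) \<and> hd (ys @ (y # xs)) \<in> U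
      \<and> set ys \<subseteq> U \<and> length (ys @ (y # xs)) = m" by blast
  then show ?case using y by (intro exI[of _ "ys @ [y]"]) (cases ys, auto)
qed

text \<open>The first \<open>j\<close> edges are subdivided one after the other. \<open>F\<close>
  holds the forbidden vertices. Each new vertex of \<open>L\<close> joins \<open>F\<close>, so
  \<open>card (F \<inter> L) + j\<close> stays the same along the induction, and as it is at most
  \<open>l\<close>, every edge treated has a common neighbour in \<open>L\<close> outside
  \<open>F\<close>.\<close>

lemma subdivide_path:
  assumes "sym A"
  shows "distinct xs \<Longrightarrow> walk R xs \<Longrightarrow> R \<subseteq> {(x, y) \<in> A. l \<le> card (A `` {x} \<inter> A `` {y} \<inter> L)}
    \<Longrightarrow> finite L \<Longrightarrow> set xs \<subseteq> F \<Longrightarrow> card (F \<inter> L) + j \<le> l \<Longrightarrow> j < length xs \<Longrightarrow>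
    \<exists>ys. distinct ys \<and> walk A ys \<and> hd ys = hd xs \<and> last ys = last xs \<and> length ys = length xs + j
      \<and> set ys \<inter> F = set xs \<and> set ys \<subseteq> set xs \<union> L"
proof (induction xs arbitrary: F j)
  case Nil
  then show ?case by simp
next
  case (Cons x xs)
  show ?case
  proof (cases j)
    case 0
    have "R \<subseteq> A" using Cons.prems by auto
    then show ?thesis using 0 Cons.prems walk_mono[of R "x # xs" A]
      by (intro exI[of _ "x # xs"]) auto
  next
    case (Suc j')
    then obtain y xs' where xs: "xs = y # xs'" using Cons.prems by (cases xs) auto
    have "(x, y) \<in> R" using Cons.prems xs by auto
    then have "l \<le> card (A `` {x} \<inter> A `` {y} \<inter> L)" using Cons.prems by auto
    then have "card (F \<inter> L) < card (A `` {x} \<inter> A `` {y} \<inter> L)" using Cons.prems Suc by linarith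
    then have "\<not> A `` {x} \<inter> A `` {y} \<inter> L \<subseteq> F \<inter> L"
      using card_mono[of "F \<inter> L" "A `` {x} \<inter> A `` {y} \<inter> L"] Cons.prems by auto
    then obtain s where s: "(x, s) \<in> A" "(y, s) \<in> A" "s \<in> L" "s \<notin> F" by auto
    have "insert s F \<inter> L = insert s (F \<inter> L)" using s by auto
    then have "card (insert s F \<inter> L) = Suc (card (F \<inter> L))" using s Cons.prems by simp
    then have "\<exists>ys. distinct ys \<and> walk A ys \<and> hd ys = hd xs \<and> last ys = last xs
        \<and> length ys = length xs + j' \<and> set ys \<inter> insert s F = set xs \<and> set ys \<subseteq> set xs \<union> L"
      using Cons.prems Suc xs by (intro Cons.IH) auto
    then obtain ys where ys: "distinct ys" "walk A ys" "hd ys = hd xs" "last ys = last xs"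
      "length ys = length xs + j'" "set ys \<inter> insert s F = set xs" "set ys \<subseteq> set xs \<union> L" by blast
    have "ys \<noteq> []" using ys(5) xs by auto
    have "s \<notin> set xs" "x \<notin> set xs" "x \<in> F" using s Cons.prems by auto
    then have "s \<notin> set ys" "x \<notin> set ys" "x \<noteq> s" using ys(6) s(4) by auto
    then show ?thesis using ys s xs Suc \<open>ys \<noteq> []\<close> symD[OF \<open>sym A\<close> s(2)] \<open>x \<in> F\<close>
      by (intro exI[of _ "x # s # ys"]) (auto simp: successively_Cons)
  qed
qed

section \<open>Cycles with many vertices from a given set\<close>

text \<open>The arcs that can be subdivided by a vertex of \<open>L\<close>, even when fewer than \<open>l\<close> of these are taken.\<close>

definition rich :: "('a \<times> 'a) set \<Rightarrow> 'a set \<Rightarrow> nat \<Rightarrow> ('a \<times> 'a) set" where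
  "rich A L l = {(x, y) \<in> A. l \<le> card (A `` {x} \<inter> A `` {y} \<inter> L)}"

text \<open>The rich arcs inside the neighbourhood of \<open>l0\<close> are numerous enough for a
  rich path on \<open>l\<close> vertices. Subdividing it until it has, together with
  \<open>l0\<close>, at least \<open>l\<close> vertices in \<open>L\<close> gives at most
  \<open>2 * l - 1 \<le> r - 1\<close> vertices. The triangles at \<open>l0\<close> prolong it to
  \<open>r - 1\<close> vertices inside the neighbourhood, and \<open>l0\<close> closes the
  cycle.\<close>

lemma find_cycle:
  assumes sg: "sgraph V A" and "L \<subseteq> V" "l0 \<in> L" "1 \<le> l" "2 * l \<le> r" "3 \<le> r"
    and dense: "2 * (l - 2) * card (A `` {l0}) < card (rich A L l \<inter> A `` {l0} \<times> A `` {l0})"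
    and triangles: "\<And>x. (l0, x) \<in> A \<Longrightarrow> r - 1 \<le> card (A `` {x} \<inter> A `` {l0}) + 1"
  shows "\<exists>xs. is_cyc A xs \<and> length xs = r \<and> l \<le> card (set xs \<inter> L)"
proof -
  let ?N = "A `` {l0}" and ?R = "rich A L l"
  have symA: "sym A" and irA: "irrefl A" using sg by (auto simp: sgraph_def)
  have finN: "finite ?N" using sgraph_finite_nbrs[OF sg] .
  have finL: "finite L" using assms(2) sgraph_finite[OF sg] finite_subset by blast
  have RA: "?R \<subseteq> A" by (auto simp: rich_def)
  have symR: "sym ?R"
  proof (rule symI)
    fix x y assume "(x, y) \<in> ?R"
    then show "(y, x) \<in> ?R" using sgraph_sym[OF sg, of x y] by (simp add: rich_def Int_commute)
  qed
  have irR: "irrefl ?R" using irA RA by (auto simp: irrefl_def)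
  obtain U where U: "U \<subseteq> ?N" "U \<noteq> {}" "\<And>x. x \<in> U \<Longrightarrow> l - 2 < card (?R `` {x} \<inter> U)"
    using min_degree_subset[OF finN symR dense] by blast
  then obtain w where w: "w \<in> U" by blast
  have "\<exists>ys. distinct (ys @ [w]) \<and> walk ?R (ys @ [w]) \<and> hd (ys @ [w]) \<in> U \<and> set ys \<subseteq> U
      \<and> length (ys @ [w]) = l"
  proof (rule extend_path[OF _ _ symR irR])
    show "l \<le> card (?R `` {x} \<inter> U) + 1" if "x \<in> U" for x using U(3)[OF that] by linarith
  qed (use w U finN finite_subset \<open>1 \<le> l\<close> in auto)
  then obtain P where P: "distinct P" "walk ?R P" "set P \<subseteq> U" "length P = l"
    using w by (metis Un_insert_right empty_set insert_subset list.simps(15) set_append sup_bot.right_neutral)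
  let ?X = "insert l0 (set P)"
  have l0: "l0 \<notin> ?N" using sgraph_irrefl[OF sg] by auto
  have "l0 \<notin> set P" using l0 P(3) U(1) by blast
  have "P \<noteq> []" using P(4) \<open>1 \<le> l\<close> by auto
  have walkP: "walk A P" using walk_mono[OF P(2) RA] .
  have "\<exists>Q. distinct Q \<and> walk A Q \<and> hd Q = hd P \<and> last Q = last P \<and> Q \<noteq> [] \<and> length Q \<le> r - 1
      \<and> l0 \<notin> set Q \<and> l \<le> card (insert l0 (set Q) \<inter> L)"
  proof (cases "l \<le> card (?X \<inter> L)")
    case True
    then show ?thesis using P walkP \<open>P \<noteq> []\<close> \<open>l0 \<notin> set P\<close> assms(4-6)
      by (intro exI[of _ P]) auto
  next
    case False
    define j where "j = l - card (?X \<inter> L)"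
    \<comment> \<open>Since \<open>l0\<close> itself counts, at most \<open>l - 1\<close>
      subdivisions are missing, and \<open>P\<close> has \<open>l - 1\<close> edges.\<close>
    have "0 < card (?X \<inter> L)" using finL \<open>l0 \<in> L\<close> by (subst card_gt_0_iff) blast
    then have j: "j < l" "card (?X \<inter> L) + j = l" using False unfolding j_def by linarith+
    obtain Q where Q: "distinct Q" "walk A Q" "hd Q = hd P" "last Q = last P" "length Q = length P + j"
       "set Q \<inter> ?X = set P" "set Q \<subseteq> set P \<union> L"
      using subdivide_path[OF symA P(1,2), of l L ?X j] j finL P(4) by (auto simp: rich_def)
    have "l0 \<notin> set Q" using Q(6) \<open>l0 \<notin> set P\<close> by blast
    have "card (set Q - set P) = j"
      using Q(1,5,6) P(1) by (subst card_Diff_subset) (auto simp: distinct_card)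
    moreover have "card (?X \<inter> L \<union> (set Q - set P)) = card (?X \<inter> L) + card (set Q - set P)"
      using Q(6) by (intro card_Un_disjoint) auto
    moreover have "?X \<inter> L \<union> (set Q - set P) \<subseteq> insert l0 (set Q) \<inter> L"
      using Q(6,7) by auto
    ultimately have "l \<le> card (insert l0 (set Q) \<inter> L)"
      using j(2) card_mono[of "insert l0 (set Q) \<inter> L" "?X \<inter> L \<union> (set Q - set P)"] by simp
    then show ?thesis using Q \<open>l0 \<notin> set Q\<close> j P(4) assms(4-6)
      by (intro exI[of _ Q]) auto
  qed
  then obtain Q where Q: "distinct Q" "walk A Q" "hd Q = hd P" "last Q = last P" "Q \<noteq> []"
    "length Q \<le> r - 1" "l0 \<notin> set Q" "l \<le> card (insert l0 (set Q) \<inter> L)" by blast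
  have hdP: "hd P \<in> ?N" "last P \<in> ?N" using P(3) U(1) \<open>P \<noteq> []\<close> hd_in_set last_in_set by blast+
  \<comment> \<open>New vertices are put only in front of \<open>Q\<close>, so the last vertex
    remains \<open>last P\<close>, a neighbour of \<open>l0\<close>.\<close>
  have "\<exists>ys. distinct (ys @ Q) \<and> walk A (ys @ Q) \<and> hd (ys @ Q) \<in> ?N \<and> set ys \<subseteq> ?N
      \<and> length (ys @ Q) = r - 1"
    by (rule extend_path[OF _ finN symA irA Q(1,2,5) _ Q(6)])
      (use triangles hdP Q(3) in \<open>auto\<close>)
  then obtain ys where ys: "distinct (ys @ Q)" "walk A (ys @ Q)" "hd (ys @ Q) \<in> ?N" "set ys \<subseteq> ?N"
    "length (ys @ Q) = r - 1" by blast
  let ?c = "l0 # ys @ Q"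
  have "is_cyc A ?c"
    unfolding is_cyc_def
  proof (intro conjI)
    show "distinct ?c" using ys(1,4) l0 Q(7) by auto
    show "3 \<le> length ?c" using ys(5) assms(6) by simp
    show "walk A ?c" using ys(2,3) Q(5) by (auto simp: successively_Cons)
    show "(last ?c, hd ?c) \<in> A" using hdP(2) Q(4,5) sgraph_sym[OF sg] by auto
  qed
  moreover have "length ?c = r" using ys(5) assms(6) by simp
  moreover have "l \<le> card (set ?c \<inter> L)"
    using Q(8) card_mono[of "set ?c \<inter> L" "insert l0 (set Q) \<inter> L"] by fastforce
  ultimately show ?thesis by blast
qed

section \<open>Counting arcs in neighbourhoods and arcs lost by deletion\<close>

text \<open>Count the pairs of a vertex \<open>v \<in> L\<close> and a non-rich arc inside its
  neighbourhood. With \<open>d\<close> the degree of \<open>v\<close>, at least \<open>d * t\<close>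
  arcs lie there and at most \<open>2 * (l - 2) * d\<close> of them are rich. Conversely, a non-rich
  arc has at most \<open>l - 1\<close> common neighbours in \<open>L\<close>.\<close>

lemma poor_neighbourhoods_bound:
  fixes t :: real
  assumes sg: "sgraph V A" and "L \<subseteq> V" "1 \<le> l"
    and triangles: "\<And>x y. (x, y) \<in> A \<Longrightarrow> t \<le> card (A `` {x} \<inter> A `` {y})"
    and poor: "\<And>v. v \<in> L \<Longrightarrow> card (rich A L l \<inter> A `` {v} \<times> A `` {v}) \<le> 2 * (l - 2) * card (A `` {v})"
  shows "(\<Sum>v\<in>L. card (A `` {v}) * (t - 2 * real (l - 2))) \<le> (real l - 1) * card A"
proof -
  have finA: "finite A" using sgraph_finite_arcs[OF sg] .
  have finL: "finite L" using assms(2) sgraph_finite[OF sg] finite_subset by blast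
  have finN: "finite (A `` {v})" for v using sgraph_finite_nbrs[OF sg] .
  let ?N = "\<lambda>v. A `` {v}"
  let ?P = "A - rich A L l"
  define q where "q = l - 2"
  have low: "real (card (?N v)) * (t - 2 * real (l - 2)) \<le> real (card (?P \<inter> ?N v \<times> ?N v))"
    if v: "v \<in> L" for v
  proof -
    have "real (card (?N v)) * t = (\<Sum>x\<in>?N v. t)" by simp
    also have "\<dots> \<le> (\<Sum>x\<in>?N v. real (card ((A \<inter> ?N v \<times> ?N v) `` {x})))"
    proof (rule sum_mono)
      fix x assume x: "x \<in> ?N v"
      then have "(A \<inter> ?N v \<times> ?N v) `` {x} = A `` {v} \<inter> A `` {x}" by auto
      then show "t \<le> real (card ((A \<inter> ?N v \<times> ?N v) `` {x}))" using triangles[of v x] x by simp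
    qed
    also have "\<dots> = real (card (A \<inter> ?N v \<times> ?N v))"
      using card_eq_sum_Image[OF finN, of "A \<inter> ?N v \<times> ?N v" v] by simp
    also have "A \<inter> ?N v \<times> ?N v = (?P \<inter> ?N v \<times> ?N v) \<union> (rich A L l \<inter> ?N v \<times> ?N v)"
      by (auto simp: rich_def)
    also have "real (card \<dots>) \<le> real (card (?P \<inter> ?N v \<times> ?N v)) + real (card (rich A L l \<inter> ?N v \<times> ?N v))"
      unfolding of_nat_add[symmetric] by (rule of_nat_mono[OF card_Un_le])
    also have "\<dots> \<le> real (card (?P \<inter> ?N v \<times> ?N v)) + real (2 * (l - 2) * card (A `` {v}))"
      using poor[OF v] by (intro add_left_mono of_nat_mono)
    finally show ?thesis unfolding q_def[symmetric] by (simp add: algebra_simps)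
  qed
  have "(\<Sum>v\<in>L. card (?P \<inter> ?N v \<times> ?N v)) = (\<Sum>v\<in>L. \<Sum>p\<in>?P. if p \<in> ?N v \<times> ?N v then 1 else 0)"
  proof (intro sum.cong refl)
    fix v
    have "card (?P \<inter> ?N v \<times> ?N v) = (\<Sum>p\<in>{p \<in> ?P. p \<in> ?N v \<times> ?N v}. 1)"
      unfolding Int_def by simp
    also have "\<dots> = (\<Sum>p\<in>?P. if p \<in> ?N v \<times> ?N v then 1 else 0)"
      using finA by (intro sum.inter_filter) simp
    finally show "card (?P \<inter> ?N v \<times> ?N v) = (\<Sum>p\<in>?P. if p \<in> ?N v \<times> ?N v then 1 else 0)" .
  qed
  also have "\<dots> = (\<Sum>p\<in>?P. \<Sum>v\<in>L. if p \<in> ?N v \<times> ?N v then 1 else 0)" by (rule sum.swap)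
  also have "\<dots> \<le> (\<Sum>p\<in>?P. l - 1)"
  proof (rule sum_mono)
    fix p assume "p \<in> ?P"
    then obtain x y where p: "p = (x, y)" "(x, y) \<in> ?P" by (cases p) auto
    have "(\<Sum>v\<in>L. if p \<in> ?N v \<times> ?N v then 1 else 0) = card {v \<in> L. p \<in> ?N v \<times> ?N v}"
      using sum.inter_filter[OF finL, of "\<lambda>_. 1::nat" "\<lambda>v. p \<in> ?N v \<times> ?N v"] by simp
    also have "{v \<in> L. p \<in> ?N v \<times> ?N v} = A `` {x} \<inter> A `` {y} \<inter> L"
      using sgraph_sym[OF sg, of x] sgraph_sym[OF sg, of y] sgraph_sym[OF sg, of _ x]
        sgraph_sym[OF sg, of _ y] by (simp only: p) blast
    also have "card \<dots> \<le> l - 1" using p(2) unfolding rich_def by (simp; linarith)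
    finally show "(\<Sum>v\<in>L. if p \<in> ?N v \<times> ?N v then 1 else 0) \<le> l - 1" .
  qed
  also have "\<dots> \<le> (l - 1) * card A" using finA card_mono[of A ?P] by simp
  finally have *: "(\<Sum>v\<in>L. card (?P \<inter> ?N v \<times> ?N v)) \<le> (l - 1) * card A" .
  have "(\<Sum>v\<in>L. card (A `` {v}) * (t - 2 * real (l - 2))) \<le> (\<Sum>v\<in>L. real (card (?P \<inter> ?N v \<times> ?N v)))"
    using low by (rule sum_mono)
  also have "\<dots> \<le> real ((l - 1) * card A)" unfolding of_nat_sum[symmetric] using * by (rule of_nat_mono)
  also have "\<dots> = (real l - 1) * card A" using \<open>1 \<le> l\<close> by (simp add: of_nat_diff)
  finally show ?thesis .
qed

lemma card_off_diagonal:
  assumes "finite R"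
  shows "real (card (R \<times> R - Id)) = card R * (real (card R) - 1)"
proof -
  have "(SIGMA x:R. R - {x}) = R \<times> R - Id" by auto
  moreover have "card (SIGMA x:R. R - {x}) = (\<Sum>x\<in>R. card (R - {x}))" using assms by simp
  moreover have "(\<Sum>x\<in>R. real (card (R - {x}))) = (\<Sum>x\<in>R. real (card R) - 1)"
  proof (rule sum.cong[OF refl])
    fix x assume x: "x \<in> R"
    then have "card R > 0" using assms card_gt_0_iff by blast
    then show "real (card (R - {x})) = real (card R) - 1" using x assms by (simp add: of_nat_diff)
  qed
  ultimately show ?thesis by simp
qed

text \<open>The arcs lost with \<open>C\<close> either meet \<open>S\<close>, which costs at most
  \<open>2 * D\<close> per vertex of \<open>S\<close>, or join the \<open>m\<close> other vertices
  of \<open>C\<close> to \<open>V - C\<close> or to each other. With \<open>C = S = {v}\<close> this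
  bounds the cost of a vertex by twice its degree; with \<open>S = {}\<close> it holds for an
  arbitrary \<open>C\<close>.\<close>

lemma card_restrict_ge:
  fixes D m :: real
  assumes sg: "sgraph V A" and "C \<subseteq> V" "S \<subseteq> C" and deg: "\<And>v. v \<in> S \<Longrightarrow> card (A `` {v}) \<le> D"
    and m_def: "m = real (card (C - S))"
  shows "card A \<le> card (A \<inter> (V - C) \<times> (V - C)) + 2 * card S * D + 2 * m * card (V - C) + m * (m - 1)"
proof -
  let ?W = "V - C" and ?R = "C - S" and ?T = "SIGMA v:S. A `` {v}"
  have finV: "finite V" using sgraph_finite[OF sg] .
  have "finite C" using assms(2) finV by (rule finite_subset)
  moreover have "finite S" using assms(3) \<open>finite C\<close> by (rule finite_subset)
  ultimately have fin: "finite C" "finite S" "finite ?W" "finite ?R" using finV by simp_all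
  have finT: "finite ?T" using fin sgraph_finite_nbrs[OF sg] by auto
  have "card ?T = (\<Sum>v\<in>S. card (A `` {v}))"
    using fin sgraph_finite_nbrs[OF sg] by simp
  then have T: "real (card ?T) \<le> card S * D"
    using sum_mono[of S "\<lambda>v. real (card (A `` {v}))" "\<lambda>v. D"] deg by simp
  have R: "real (card (?R \<times> ?R - Id)) = m * (m - 1)"
    unfolding m_def by (rule card_off_diagonal[OF fin(4)])
  have "A \<subseteq> (A \<inter> ?W \<times> ?W) \<union> (?T \<union> (?T\<inverse> \<union> (?R \<times> ?W \<union> (?W \<times> ?R \<union> (?R \<times> ?R - Id)))))"
  proof
    fix p assume p: "p \<in> A"
    obtain a b where ab: "p = (a, b)" by (cases p)
    have "a \<in> V" "b \<in> V" "a \<noteq> b" "(b, a) \<in> A"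
      using p ab sgraph_arcD[OF sg, of a b] sgraph_sym[OF sg, of a b] sgraph_irrefl[OF sg] by auto
    then show "p \<in> (A \<inter> ?W \<times> ?W) \<union> (?T \<union> (?T\<inverse> \<union> (?R \<times> ?W \<union> (?W \<times> ?R \<union> (?R \<times> ?R - Id)))))"
      using p ab by auto
  qed
  then have "card A \<le> card \<dots>"
    by (rule card_mono[rotated]) (use fin finT in \<open>simp add: sgraph_finite_arcs[OF sg]\<close>)
  also have "\<dots> \<le> card (A \<inter> ?W \<times> ?W) + (card ?T + (card (?T\<inverse>) + (card (?R \<times> ?W)
      + (card (?W \<times> ?R) + card (?R \<times> ?R - Id)))))"
    by (intro order.trans[OF card_Un_le] add_mono order.refl)
  finally have "real (card A) \<le> real (card (A \<inter> ?W \<times> ?W) + (card ?T + (card (?T\<inverse>)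
      + (card (?R \<times> ?W) + (card (?W \<times> ?R) + card (?R \<times> ?R - Id))))))"
    by (rule of_nat_mono)
  also have "\<dots> = card (A \<inter> ?W \<times> ?W) + (real (card ?T) + (card ?T + (m * card ?W
      + (card ?W * m + m * (m - 1)))))"
    unfolding card_inverse card_cartesian_product of_nat_add of_nat_mult R m_def ..
  finally show ?thesis using T by (simp add: algebra_simps)
qed

section \<open>Contraction\<close>

text \<open>The edge is contracted onto \<open>u\<close>, so the vertex type stays the same. The
  added arcs leave out existing neighbours of \<open>u\<close>, which makes the union disjoint and
  the arcs countable exactly.\<close>

definition contract :: "('a \<times> 'a) set \<Rightarrow> 'a \<Rightarrow> 'a \<Rightarrow> ('a \<times> 'a) set" where
  "contract A u v = {(x, y) \<in> A. x \<noteq> v \<and> y \<noteq> v}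
     \<union> ({u} \<times> (A `` {v} - A `` {u} - {u}) \<union> (A `` {v} - A `` {u} - {u}) \<times> {u})"

lemma contract_sgraph:
  assumes sg: "sgraph V A" and "(u, v) \<in> A"
  shows "sgraph (V - {v}) (contract A u v)"
proof -
  have "u \<noteq> v" "u \<in> V" using sgraph_irrefl[OF sg] sgraph_arcD[OF sg] assms(2) by auto
  then show ?thesis
    using sgraph_finite[OF sg] sgraph_sym[OF sg] sgraph_irrefl[OF sg] sgraph_arcD[OF sg]
    unfolding sgraph_def contract_def sym_def irrefl_def by (auto; blast)
qed

text \<open>The edges lost are \<open>uv\<close> itself and, for each common neighbour, one of the
  two edges that become parallel.\<close>

lemma card_contract:
  assumes sg: "sgraph V A" and uv: "(u, v) \<in> A"
  shows "card (contract A u v) + 2 * card (A `` {u} \<inter> A `` {v}) + 2 = card A"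
proof -
  let ?B = "{(x, y) \<in> A. x \<noteq> v \<and> y \<noteq> v}" and ?M = "A `` {v} - A `` {u} - {u}"
  let ?N = "A `` {v}"
  have vu: "(v, u) \<in> A" and "u \<noteq> v"
    using sgraph_sym[OF sg uv] uv sgraph_irrefl[OF sg] by auto
  have finA: "finite A" using sgraph_finite_arcs[OF sg] .
  have finN: "finite ?N" using sgraph_finite_nbrs[OF sg] .
  have finB: "finite ?B" using finA by (rule finite_subset[rotated]) auto
  have v: "v \<notin> ?N" using sgraph_irrefl[OF sg] by auto
  have "A = ?B \<union> ({v} \<times> ?N \<union> ?N \<times> {v})" using sgraph_sym[OF sg, of v] sgraph_sym[OF sg, of _ v] by auto
  moreover have "card (?B \<union> ({v} \<times> ?N \<union> ?N \<times> {v})) = card ?B + card ({v} \<times> ?N \<union> ?N \<times> {v})"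
    using finB finN by (intro card_Un_disjoint) auto
  moreover have "card ({v} \<times> ?N \<union> ?N \<times> {v}) = card ({v} \<times> ?N) + card (?N \<times> {v})"
    using finN v by (intro card_Un_disjoint) auto
  ultimately have A: "card A = card ?B + 2 * card ?N"
    by (simp add: card_cartesian_product)
  have M: "finite ?M" "u \<notin> ?M" using finN by auto
  have "card (contract A u v) = card ?B + card ({u} \<times> ?M \<union> ?M \<times> {u})"
    unfolding contract_def using finB M sgraph_sym[OF sg, of _ u]
    by (intro card_Un_disjoint) auto
  moreover have "card ({u} \<times> ?M \<union> ?M \<times> {u}) = card ({u} \<times> ?M) + card (?M \<times> {u})"
    using M by (intro card_Un_disjoint) auto
  ultimately have C: "card (contract A u v) = card ?B + 2 * card ?M"
    by (simp add: card_cartesian_product)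
  have "?N = insert u (?M \<union> A `` {u} \<inter> ?N)" using vu by auto
  moreover have "u \<notin> ?M \<union> A `` {u} \<inter> ?N" using sgraph_irrefl[OF sg] by auto
  moreover have "card (?M \<union> A `` {u} \<inter> ?N) = card ?M + card (A `` {u} \<inter> ?N)"
    using finN by (intro card_Un_disjoint) auto
  moreover have "finite (?M \<union> A `` {u} \<inter> ?N)" using finN by simp
  ultimately have "card ?N = Suc (card ?M + card (A `` {u} \<inter> ?N))"
    by (metis card_insert_disjoint)
  then show ?thesis using A C by simp
qed

text \<open>Each of the two cycle edges at \<open>u\<close> comes from an edge at \<open>u\<close>
  or at \<open>v\<close>. If both come from the same vertex, that vertex takes the place of
  \<open>u\<close>; otherwise the edge \<open>uv\<close> is inserted there.\<close>

lemma contract_is_cyc: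
  assumes sg: "sgraph V A" and uv: "(u, v) \<in> A" and cyc: "is_cyc (contract A u v) xs"
  shows "\<exists>ys. is_cyc A ys \<and> length xs \<le> length ys
    \<and> set ys \<subseteq> set xs \<union> (if u \<in> set xs then {v} else {})"
proof (cases "u \<in> set xs")
  case False
  have "walk A xs"
    using cyc unfolding is_cyc_def
    by (auto elim!: successively_mono simp: contract_def) (use False in auto)
  moreover have "(last xs, hd xs) \<in> A"
  proof -
    have "xs \<noteq> []" using cyc by (auto simp: is_cyc_def)
    then have "last xs \<noteq> u" "hd xs \<noteq> u" using False last_in_set hd_in_set by metis+
    then show ?thesis using cyc by (auto simp: is_cyc_def contract_def)
  qed
  ultimately show ?thesis using cyc by (intro exI[of _ xs]) (auto simp: is_cyc_def)
next
  case True
  let ?A' = "contract A u v"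
  have sg': "sgraph (V - {v}) ?A'" using contract_sgraph[OF sg uv] .
  have vu: "(v, u) \<in> A" "u \<noteq> v" using sgraph_sym[OF sg uv] uv sgraph_irrefl[OF sg] by auto
  obtain as bs where xs: "xs = as @ u # bs" using True by (meson split_list)
  define ys where "ys = bs @ as"
  have "is_cyc ?A' ((u # bs) @ as)" using is_cyc_rotate[of ?A' as "u # bs"] cyc xs by simp
  then have c: "is_cyc ?A' (u # ys)" by (simp add: ys_def)
  have sets: "set xs = set (u # ys)" "length xs = length (u # ys)" by (auto simp: xs ys_def)
  have "ys \<noteq> []" "2 \<le> length ys" "distinct ys" "u \<notin> set ys" using c by (auto simp: is_cyc_def)
  have "set (u # ys) \<subseteq> V - {v}" using is_cyc_subset[OF c, of "V - {v}"] sg' unfolding sgraph_def by blast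
  then have "v \<notin> set ys" by auto
  have w': "walk ?A' ys" "(u, hd ys) \<in> ?A'" "(last ys, u) \<in> ?A'"
    using c \<open>ys \<noteq> []\<close> by (auto simp: is_cyc_def successively_Cons)
  have w: "walk A ys" using w'(1)
    by (rule successively_mono) (use \<open>u \<notin> set ys\<close> in \<open>auto simp: contract_def\<close>)
  have h: "(u, hd ys) \<in> A \<or> (v, hd ys) \<in> A" using w'(2) vu by (auto simp: contract_def)
  have l: "(last ys, u) \<in> A \<or> (last ys, v) \<in> A"
    using w'(3) vu sgraph_sym[OF sg, of v] by (auto simp: contract_def)
  note facts = w uv vu \<open>ys \<noteq> []\<close> \<open>2 \<le> length ys\<close> \<open>distinct ys\<close> \<open>u \<notin> set ys\<close> \<open>v \<notin> set ys\<close>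
  consider "(u, hd ys) \<in> A" "(last ys, u) \<in> A" | "(v, hd ys) \<in> A" "(last ys, v) \<in> A"
    | "(u, hd ys) \<in> A" "(last ys, v) \<in> A" | "(v, hd ys) \<in> A" "(last ys, u) \<in> A"
    using h l by blast
  then show ?thesis
  proof cases
    case 1
    then have "is_cyc A (u # ys)" using facts by (auto simp: is_cyc_def successively_Cons)
    then show ?thesis using sets True by (intro exI[of _ "u # ys"]) auto
  next
    case 2
    then have "is_cyc A (v # ys)" using facts by (auto simp: is_cyc_def successively_Cons)
    then show ?thesis using sets True by (intro exI[of _ "v # ys"]) auto
  next
    case 3
    then have "is_cyc A (v # u # ys)" using facts by (auto simp: is_cyc_def successively_Cons)
    then show ?thesis using sets True by (intro exI[of _ "v # u # ys"]) auto
  next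
    case 4
    then have "is_cyc A (u # v # ys)" using facts by (auto simp: is_cyc_def successively_Cons)
    then show ?thesis using sets True by (intro exI[of _ "u # v # ys"]) auto
  qed
qed

text \<open>At most one of the disjoint cycles contains \<open>u\<close>, so at most one of the
  lifted cycles receives \<open>v\<close>.\<close>

lemma contract_has_long_cycles:
  assumes sg: "sgraph V A" and uv: "(u, v) \<in> A" and "has_long_cycles (contract A u v) r k"
  shows "has_long_cycles A r k"
proof -
  let ?A' = "contract A u v"
  obtain C where C: "\<And>i. i < k \<Longrightarrow> is_cyc ?A' (C i) \<and> r \<le> length (C i)"
    "disjoint_family_on (\<lambda>i. set (C i)) {..<k}"
    using assms(3) unfolding has_long_cycles_def by blast
  let ?E = "\<lambda>i. if u \<in> set (C i) then {v} else {}"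
  have "\<forall>i<k. \<exists>ys. is_cyc A ys \<and> r \<le> length ys \<and> set ys \<subseteq> set (C i) \<union> ?E i"
    using contract_is_cyc[OF sg uv] C(1) order.trans by meson
  then obtain D where D: "\<And>i. i < k \<Longrightarrow> is_cyc A (D i) \<and> r \<le> length (D i) \<and> set (D i) \<subseteq> set (C i) \<union> ?E i"
    by metis
  have v: "v \<notin> set (C i)" if "i < k" for i
    using C(1)[OF that] is_cyc_subset[of ?A' "C i" "V - {v}"] contract_sgraph[OF sg uv]
    by (auto simp: sgraph_def)
  have "disjoint_family_on (\<lambda>i. set (D i)) {..<k}"
    unfolding disjoint_family_on_def
  proof (intro ballI impI)
    fix i j assume ij: "i \<in> {..<k}" "j \<in> {..<k}" "i \<noteq> j"
    have "set (C i) \<inter> set (C j) = {}" using disjoint_family_onD[OF C(2) ij] .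
    moreover have "v \<notin> set (C i)" "v \<notin> set (C j)" using v ij by auto
    ultimately have "(set (C i) \<union> ?E i) \<inter> (set (C j) \<union> ?E j) = {}" by auto
    moreover have "set (D i) \<subseteq> set (C i) \<union> ?E i" "set (D j) \<subseteq> set (C j) \<union> ?E j"
      using D ij by blast+
    ultimately show "set (D i) \<inter> set (D j) = {}" by blast
  qed
  then show ?thesis unfolding has_long_cycles_def using D by blast
qed

section \<open>Reduction to minimal dense graphs\<close>

text \<open>A dense graph without the cycles, chosen with \<open>card V + card A\<close> minimal,
  has the three properties given to \<open>core\<close>: otherwise deleting an edge, contracting an
  edge or deleting \<open>S\<close> leaves a smaller dense graph. A contraction lowers the required
  number of arcs by \<open>2 * B\<close> and loses two arcs plus two for each common neighbour,
  whence the bound \<open>B - 1\<close>.\<close>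

lemma minimal_dense_induct:
  fixes B :: real and V :: "'a set" and A :: "('a \<times> 'a) set"
  assumes "0 \<le> B"
    and core: "\<And>(V :: 'a set) A. sgraph V A \<Longrightarrow> V \<noteq> {} \<Longrightarrow> 2 * B * card V \<le> card A
      \<Longrightarrow> card A < 2 * B * card V + 2
      \<Longrightarrow> (\<And>x y. (x, y) \<in> A \<Longrightarrow> B - 1 < card (A `` {x} \<inter> A `` {y}))
      \<Longrightarrow> (\<And>S. S \<subseteq> V \<Longrightarrow> card (A \<inter> (V - S) \<times> (V - S)) + 2 * B * card S \<le> card A)
      \<Longrightarrow> has_long_cycles A r k"
  shows "sgraph V A \<Longrightarrow> V \<noteq> {} \<Longrightarrow> 2 * B * card V \<le> card A \<Longrightarrow> has_long_cycles A r k"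
proof (induction "card V + card A" arbitrary: V A rule: less_induct)
  case less
  note sg = less.prems(1)
  have finV: "finite V" using sgraph_finite[OF sg] .
  have finA: "finite A" using sgraph_finite_arcs[OF sg] .
  show ?case
  proof (rule ccontr)
    assume none: "\<not> has_long_cycles A r k"
    have "card A < 2 * B * card V + 2"
    proof (rule ccontr)
      assume "\<not> ?thesis"
      then have ge: "2 * B * card V + 2 \<le> card A" by simp
      have "0 \<le> 2 * B * card V" using assms(1) by simp
      then have "0 < real (card A)" using ge by linarith
      then have "A \<noteq> {}" by auto
      then obtain x y where xy: "(x, y) \<in> A" by auto
      let ?A = "A - {(x, y), (y, x)}"
      have "x \<noteq> y" "(y, x) \<in> A" using xy sgraph_irrefl[OF sg] sgraph_sym[OF sg] by auto
      then have c: "card A = card ?A + 2"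
        using xy finA card_Diff_subset[of "{(x, y), (y, x)}" A] card_mono[of A "{(x, y), (y, x)}"] by simp
      moreover have "sgraph V ?A" using sg by (auto simp: sgraph_def sym_def irrefl_def)
      ultimately have "has_long_cycles ?A r k"
        using ge less.prems(2) by (intro less.hyps[of V ?A]) auto
      then show False using none has_long_cycles_mono[of ?A r k A] by auto
    qed
    moreover have "B - 1 < card (A `` {x} \<inter> A `` {y})" if xy: "(x, y) \<in> A" for x y
    proof (rule ccontr)
      assume "\<not> ?thesis"
      then have t: "card (A `` {x} \<inter> A `` {y}) \<le> B - 1" by simp
      let ?A = "contract A x y" and ?V = "V - {y}"
      have "x \<in> V" "y \<in> V" "x \<noteq> y" using xy sgraph_arcD[OF sg xy] sgraph_irrefl[OF sg] by auto
      then have "?V \<noteq> {}" by auto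
      have c: "card ?A + 2 * card (A `` {x} \<inter> A `` {y}) + 2 = card A" by (rule card_contract[OF sg xy])
      have cV: "card ?V + 1 = card V" using \<open>y \<in> V\<close> finV card_Suc_Diff1 by fastforce
      have "real (card ?A) = card A - 2 * real (card (A `` {x} \<inter> A `` {y})) - 2" using c by linarith
      also have "\<dots> \<ge> 2 * B * card V - 2 * B" using t less.prems(3) by linarith
      also have "2 * B * card V - 2 * B = 2 * B * card ?V" by (simp add: cV[symmetric] algebra_simps)
      finally have "has_long_cycles ?A r k"
        using c cV contract_sgraph[OF sg xy] \<open>?V \<noteq> {}\<close> by (intro less.hyps[of ?V ?A]) auto
      then show False using none contract_has_long_cycles[OF sg xy] by blast
    qed
    moreover have "card (A \<inter> (V - S) \<times> (V - S)) + 2 * B * card S \<le> card A" if S: "S \<subseteq> V" for S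
    proof (rule ccontr)
      assume less': "\<not> ?thesis"
      let ?V = "V - S" and ?A = "A \<inter> (V - S) \<times> (V - S)"
      have cV: "card V = card ?V + card S"
        using S finV by (metis Diff_disjoint Un_Diff_cancel2 card_Un_disjoint finite_Diff finite_subset
          inf_commute sup.absorb1 sup_commute)
      have "S \<noteq> {}"
      proof
        assume "S = {}"
        moreover have "card (A \<inter> V \<times> V) \<le> card A" using finA by (intro card_mono) auto
        ultimately show False using less' by simp
      qed
      then have "0 < card S" using S finV by (meson card_gt_0_iff finite_subset)
      \<comment> \<open>If \<open>S\<close> were all of \<open>V\<close>, the failure of the
        inequality would say that \<open>card A\<close> is below
        \<open>2 * B * card V\<close>.\<close>
      have "?V \<noteq> {}"
      proof
        assume e: "?V = {}"
        have "card S = card V" "?A = {}" using cV unfolding e by simp_all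
        then show False using less' less.prems(3) by simp
      qed
      have "2 * B * card ?V \<le> card ?A"
        using less' less.prems(3) by (simp add: cV algebra_simps)
      moreover have "card ?A \<le> card A" using finA by (intro card_mono) auto
      moreover have "sgraph ?V ?A" using sgraph_restrict[OF sg] by blast
      ultimately have "has_long_cycles ?A r k"
        using cV \<open>0 < card S\<close> \<open>?V \<noteq> {}\<close> by (intro less.hyps[of ?V ?A]) auto
      then show False using none has_long_cycles_mono[of ?A r k A] by auto
    qed
    ultimately show False using core[OF less.prems] none by blast
  qed
qed

section \<open>A single long cycle\<close>

text \<open>
  Among the longest paths, take one whose first vertex has a neighbour of largest index \<open>j\<close>. Rotating
  at any neighbour of the first vertex gives another such path, so the predecessors \<open>S\<close> of these
  neighbours have all their neighbours among the first \<open>j + 1 < r\<close> vertices. Hence \<open>S\<close> meets so few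
  edges that it could be deleted.
\<close>

lemma long_cycle:
  assumes sg: "sgraph V A" and "V \<noteq> {}" "3 \<le> r" "2 * (2 / 3 * real r) * card V \<le> card A"
  shows "has_long_cycles A r 1"
proof (rule minimal_dense_induct[of "2 / 3 * real r", OF _ _ assms(1,2,4)])
  show "0 \<le> 2 / 3 * real r" by simp
next
  fix V and A :: "('a \<times> 'a) set"
  let ?B = "2 / 3 * real r"
  assume sg: "sgraph V A" and "V \<noteq> {}"
    and rem: "\<And>S. S \<subseteq> V \<Longrightarrow> card (A \<inter> (V - S) \<times> (V - S)) + 2 * ?B * card S \<le> card A"
  have finV: "finite V" using sgraph_finite[OF sg] .
  have finA: "finite A" using sgraph_finite_arcs[OF sg] .
  have symA: "sym A" using sg by (simp add: sgraph_def)
  \<comment> \<open>Deleting the single vertex \<open>v\<close> loses at most twice its degree many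
    arcs and, by \<open>rem\<close>, at least \<open>2 * ?B\<close>.\<close>
  have deg: "?B \<le> card (A `` {v})" if "v \<in> V" for v
    using rem[of "{v}"] card_restrict_ge[OF sg, of "{v}" "{v}" "real (card (A `` {v}))" 0] that by auto
  show "has_long_cycles A r 1"
  proof (rule ccontr)
    assume none: "\<not> has_long_cycles A r 1"
    define path where "path xs \<longleftrightarrow> distinct xs \<and> walk A xs \<and> set xs \<subseteq> V \<and> xs \<noteq> []" for xs
    define good where "good = (\<lambda>(xs, j). path xs \<and> j < length xs \<and> (hd xs, xs ! j) \<in> A)"
    \<comment> \<open>The order is lexicographic: the length counts first, and the factor
      \<open>card V + 1\<close> outweighs every index.\<close>
    define f where "f = (\<lambda>(xs :: 'a list, j). length xs * (card V + 1) + j)"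
    have len: "length xs \<le> card V" if "path xs" for xs
      using that finV by (metis path_def card_mono distinct_card)
    have nbr_path: "path (y # xs) \<and> good (y # xs, 1)"
      if "path xs" "(hd xs, y) \<in> A" "y \<notin> set xs" for xs y
      using that sgraph_sym[OF sg that(2)] sgraph_arcD[OF sg that(2)]
      by (cases xs) (auto simp: path_def good_def)
    have "\<exists>p. good p"
    proof -
      obtain v where v: "v \<in> V" using \<open>V \<noteq> {}\<close> by blast
      then have "card (A `` {v}) \<noteq> 0" using deg[OF v] \<open>3 \<le> r\<close> by auto
      then obtain y where "(v, y) \<in> A" by (metis Image_singleton_iff card.empty ex_in_conv)
      then show ?thesis using nbr_path[of "[v]" y] v sgraph_irrefl[OF sg]
        by (auto simp: path_def)
    qed
    moreover have "f p < card V * (card V + 1) + card V" if "good p" for p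
    proof -
      obtain xs j where p: "p = (xs, j)" by (cases p)
      have "length xs \<le> card V" "j < length xs" using that len by (auto simp: p good_def)
      then have "length xs * (card V + 1) \<le> card V * (card V + 1)" "j < card V"
        using mult_le_mono1 by (blast, linarith)
      then show ?thesis by (simp add: p f_def)
    qed
    ultimately obtain p where p: "good p" "\<And>q. good q \<Longrightarrow> f q \<le> f p"
      using ex_has_greatest_nat[of good _ f] by (metis less_imp_le)
    obtain xs j where pj: "p = (xs, j)" by (cases p)
    have xs: "path xs" "j < length xs" "(hd xs, xs ! j) \<in> A" using p(1) by (auto simp: pj good_def)
    have j: "j < card V" using xs(2) len[OF xs(1)] by linarith
    \<comment> \<open>A neighbour of the head outside the path would give a longer path, and a
      neighbour of index above \<open>j\<close> a larger index.\<close>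
    have closed: "A `` {hd zs} \<subseteq> set (take (j + 1) zs)" if zs: "path zs" "length zs = length xs" for zs
    proof
      fix y assume "y \<in> A `` {hd zs}"
      then have y: "(hd zs, y) \<in> A" by simp
      have "y \<in> set zs"
      proof (rule ccontr)
        assume "y \<notin> set zs"
        then have "f (y # zs, 1) \<le> f p" using nbr_path[OF zs(1) y] p(2) by blast
        then show False using zs(2) j by (simp add: f_def pj)
      qed
      then obtain i where i: "i < length zs" "y = zs ! i" by (auto simp: in_set_conv_nth)
      then have "f (zs, i) \<le> f p" using p(2) zs(1) y by (auto simp: good_def)
      then have "i \<le> j" using zs(2) by (simp add: f_def pj)
      then show "y \<in> set (take (j + 1) zs)" using i by (auto simp: in_set_conv_nth)
    qed
    let ?x = "hd xs" and ?M = "set (take (j + 1) xs)"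
    have dxs: "distinct xs" "walk A xs" "set xs \<subseteq> V" "xs \<noteq> []" using xs(1) by (auto simp: path_def)
    have x0: "?x = xs ! 0" using dxs(4) by (rule hd_conv_nth)
    have "?x \<in> V" using dxs by auto
    have cM: "card ?M = j + 1" using dxs(1) xs(2) by (simp add: distinct_card)
    define I where "I = {i. i \<le> j \<and> (?x, xs ! i) \<in> A}"
    have I: "i \<noteq> 0" "i \<le> j" if "i \<in> I" for i
      using that sgraph_irrefl[OF sg, of ?x] x0 unfolding I_def by (metis mem_Collect_eq, simp)
    have finI: "finite I" by (simp add: I_def)
    have "A `` {?x} \<subseteq> (!) xs ` I"
    proof
      fix y assume y: "y \<in> A `` {?x}"
      then have "y \<in> ?M" using closed[OF xs(1) refl] by blast
      then obtain i where "i \<le> j" "y = xs ! i"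
        using xs(2) by (auto simp: in_set_conv_nth less_Suc_eq_le)
      then show "y \<in> (!) xs ` I" using y by (auto simp: I_def)
    qed
    then have "card (A `` {?x}) \<le> card I"
      using finI by (meson card_image_le card_mono finite_imageI le_trans)
    then have BI: "?B \<le> card I" using deg[OF \<open>?x \<in> V\<close>] by linarith
    let ?S = "(\<lambda>i. xs ! (i - 1)) ` I"
    have cS: "card ?S = card I"
    proof (rule card_image, rule inj_onI)
      fix a b assume ab: "a \<in> I" "b \<in> I" "xs ! (a - 1) = xs ! (b - 1)"
      then have "a - 1 = b - 1" using I[OF ab(1)] I[OF ab(2)] xs(2) dxs(1)
        by (subst (asm) nth_eq_iff_index_eq) auto
      then show "a = b" using I[OF ab(1)] I[OF ab(2)] by linarith
    qed
    have nbrS: "A `` {s} \<subseteq> ?M" if "s \<in> ?S" for s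
    proof -
      obtain i where i: "i \<in> I" "s = xs ! (i - 1)" using \<open>s \<in> ?S\<close> by blast
      note Ii = I[OF i(1)]
      \<comment> \<open>The rotation: the old head is adjacent to \<open>xs ! i\<close>, so
        reversing the segment before \<open>xs ! i\<close> gives a path with head
        \<open>xs ! (i - 1)\<close>. As \<open>i \<le> j\<close>, its first \<open>j + 1\<close>
        vertices are those of \<open>xs\<close> in another order.\<close>
      let ?z = "rev (take i xs) @ drop i xs"
      have app: "take i xs @ drop i xs = xs" by simp
      have ne: "take i xs \<noteq> []" using Ii dxs(4) by simp
      have hz: "hd ?z = s" using ne Ii xs(2) by (simp add: hd_rev last_conv_nth i(2) min_def)
      have "walk A (take i xs)" "walk A (drop i xs)"
        using dxs(2) app successively_append_iff[of _ "take i xs" "drop i xs"] by metis+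
      moreover have "last (rev (take i xs)) = ?x" using ne by (simp add: last_rev)
      moreover have "hd (drop i xs) = xs ! i" using Ii xs(2) by (simp add: hd_drop_conv_nth)
      ultimately have "walk A ?z"
        using i(1) walk_rev[OF symA] by (auto simp: successively_append_iff I_def)
      moreover have "distinct ?z" using dxs(1) app by (metis distinct_append distinct_rev set_rev)
      moreover have setz: "set ?z = set xs" using app by (metis set_append set_rev)
      ultimately have "path ?z" using dxs by (auto simp: path_def)
      moreover have "length ?z = length xs" using Ii xs(2) by simp
      ultimately have "A `` {s} \<subseteq> set (take (j + 1) ?z)" using closed[of ?z] hz by simp
      also have "take (j + 1) ?z = rev (take i xs) @ take (j + 1 - i) (drop i xs)"
        using Ii xs(2) by (simp add: min_def)
      also have "set \<dots> = set (take i xs @ take (j + 1 - i) (drop i xs))" by simp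
      also have "take i xs @ take (j + 1 - i) (drop i xs) = take (j + 1) xs"
        using Ii take_add[of i "j + 1 - i" xs] by simp
      finally show ?thesis .
    qed
    have "?S \<subseteq> ?M"
    proof
      fix s assume "s \<in> ?S"
      then obtain i where "i \<in> I" "s = xs ! (i - 1)" by blast
      then show "s \<in> ?M" using I[of i] xs(2) by (auto simp: in_set_conv_nth intro!: exI[of _ "i - 1"])
    qed
    have "I \<subseteq> {1..j}" using I by force
    then have "card I \<le> j" using card_mono[of "{1..j}" I] by simp
    then have "2 \<le> j" using BI \<open>3 \<le> r\<close> by linarith
    \<comment> \<open>The first \<open>j + 1\<close> vertices form a cycle, since the head is
      adjacent to \<open>xs ! j\<close> and \<open>2 \<le> j\<close>.\<close>
    have "j + 1 < r"
    proof (rule ccontr)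
      assume "\<not> j + 1 < r"
      let ?c = "take (j + 1) xs"
      have "?c \<noteq> []" "last ?c = xs ! j" "hd ?c = ?x" using xs(2) dxs(4) by (auto simp: last_conv_nth)
      moreover have "walk A ?c"
        using dxs(2) successively_append_iff[of _ ?c "drop (j + 1) xs"] by (metis append_take_drop_id)
      ultimately have "is_cyc A ?c" using xs dxs(1) sgraph_sym[OF sg] \<open>2 \<le> j\<close> by (auto simp: is_cyc_def)
      moreover have "r \<le> length ?c" using \<open>\<not> j + 1 < r\<close> xs(2) by simp
      ultimately have "has_long_cycles A r 1"
        unfolding has_long_cycles_def by (intro exI[of _ "\<lambda>_. ?c"]) (auto simp: disjoint_family_on_def)
      then show False using none by simp
    qed
    have finS: "finite ?S" using finI by simp
    let ?D = "?M - ?S"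
    have "A \<subseteq> (A \<inter> (V - ?S) \<times> (V - ?S)) \<union> (?S \<times> ?D \<union> (?D \<times> ?S \<union> (?S \<times> ?S - Id)))"
    proof
      fix e assume e: "e \<in> A"
      obtain a b where ab: "e = (a, b)" by (cases e)
      have *: "a \<in> V" "b \<in> V" "a \<noteq> b" "(b, a) \<in> A" "(a, b) \<in> A"
        using e ab sgraph_arcD[OF sg, of a b] sgraph_sym[OF sg, of a b] sgraph_irrefl[OF sg] by auto
      have "a \<in> ?S \<Longrightarrow> b \<in> ?M" "b \<in> ?S \<Longrightarrow> a \<in> ?M" using nbrS[of a] nbrS[of b] *(4,5) by blast+
      then show "e \<in> (A \<inter> (V - ?S) \<times> (V - ?S)) \<union> (?S \<times> ?D \<union> (?D \<times> ?S \<union> (?S \<times> ?S - Id)))"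
        unfolding ab using * by (cases "a \<in> ?S"; cases "b \<in> ?S") simp_all
    qed
    then have "card A \<le> card \<dots>"
      by (rule card_mono[rotated]) (use finA finS in simp)
    also have "\<dots> \<le> card (A \<inter> (V - ?S) \<times> (V - ?S)) + (card (?S \<times> ?D) + (card (?D \<times> ?S) + card (?S \<times> ?S - Id)))"
      by (intro order.trans[OF card_Un_le] add_mono order.refl)
    finally have "real (card A) \<le> real (card (A \<inter> (V - ?S) \<times> (V - ?S)) + (card (?S \<times> ?D) + (card (?D \<times> ?S) + card (?S \<times> ?S - Id))))"
      by (rule of_nat_mono)
    also have "\<dots> = card (A \<inter> (V - ?S) \<times> (V - ?S)) + (card ?S * real (card ?D) + (card ?D * real (card ?S) + card ?S * (real (card ?S) - 1)))"
      unfolding of_nat_add card_off_diagonal[OF finS] card_cartesian_product of_nat_mult ..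
    finally have le: "real (card A) \<le> card (A \<inter> (V - ?S) \<times> (V - ?S)) + card ?S * (2 * real (card ?D) + real (card ?S) - 1)"
      by (simp add: algebra_simps)
    have "?S \<subseteq> V" using \<open>?S \<subseteq> ?M\<close> dxs(3) set_take_subset by fast
    then have "2 * ?B * card ?S \<le> card ?S * (2 * real (card ?D) + real (card ?S) - 1)"
      using rem[of ?S] le by linarith
    then have "card ?S * (2 * ?B) \<le> card ?S * (2 * real (card ?D) + real (card ?S) - 1)"
      by (simp only: mult.commute)
    moreover have "0 < real (card ?S)" unfolding cS using BI \<open>3 \<le> r\<close> by linarith
    ultimately have "2 * ?B \<le> 2 * real (card ?D) + real (card ?S) - 1"
      by (simp only: mult_le_cancel_left_pos)
    moreover have "real (card ?D) = real (j + 1) - card ?S"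
      using cM card_Diff_subset[OF finS \<open>?S \<subseteq> ?M\<close>] card_mono[OF _ \<open>?S \<subseteq> ?M\<close>] by simp
    moreover have "2 * b \<le> 2 * x - s - 1" if "2 * b \<le> 2 * d + s - 1" "d = x - s" for b d s x :: real
      using that by simp
    \<comment> \<open>As \<open>card I \<ge> 2 * r / 3\<close> and \<open>j + 1 \<le> r - 1\<close>,
      the right side is at most \<open>4 * r / 3 - 3\<close>, while the left side is
      \<open>4 * r / 3\<close>. This is where the density \<open>2 / 3\<close> enters.\<close>
    ultimately have "2 * ?B \<le> 2 * real (j + 1) - real (card I) - 1" unfolding cS by blast
    moreover have "real (j + 1) + 1 \<le> real r" using \<open>j + 1 < r\<close> by linarith
    ultimately show False using BI by argo
  qed
qed

section \<open>Removing a cycle with many vertices of low degree\<close>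

text \<open>If no neighbourhood of a vertex in \<open>L\<close> had enough rich arcs, the double
  counting with \<open>t = B - 1\<close> and all degrees at least \<open>B\<close> would contradict
  \<open>many\<close>.\<close>

lemma exists_cycle:
  fixes B :: real
  assumes sg: "sgraph V A" and "L \<subseteq> V" "1 \<le> l" "2 * l \<le> r" "3 \<le> r" "real r \<le> B"
    and triangles: "\<And>x y. (x, y) \<in> A \<Longrightarrow> B - 1 < card (A `` {x} \<inter> A `` {y})"
    and deg: "\<And>v. v \<in> V \<Longrightarrow> B \<le> card (A `` {v})"
    and many: "(real l - 1) * card A < card L * (B * (B - 1 - 2 * real (l - 2)))"
  shows "\<exists>xs. is_cyc A xs \<and> length xs = r \<and> l \<le> card (set xs \<inter> L)"
proof -
  have "\<exists>v\<in>L. 2 * (l - 2) * card (A `` {v}) < card (rich A L l \<inter> A `` {v} \<times> A `` {v})"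
  proof (rule ccontr)
    assume "\<not> ?thesis"
    then have "(\<Sum>v\<in>L. card (A `` {v}) * (B - 1 - 2 * real (l - 2))) \<le> (real l - 1) * card A"
      using triangles by (intro poor_neighbourhoods_bound[OF sg assms(2,3)]) (auto simp: not_less intro: less_imp_le)
    moreover have "(\<Sum>v\<in>L. B * (B - 1 - 2 * real (l - 2))) \<le> (\<Sum>v\<in>L. card (A `` {v}) * (B - 1 - 2 * real (l - 2)))"
    proof (intro sum_mono mult_right_mono)
      show "B \<le> card (A `` {v})" if "v \<in> L" for v using that deg assms(2) by blast
      have "2 * (l - 2) + 1 \<le> r" using assms(3-5) by linarith
      then have "2 * real (l - 2) + 1 \<le> real r" by linarith
      then show "0 \<le> B - 1 - 2 * real (l - 2)" using assms(6) by linarith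
    qed
    ultimately show False using many by simp
  qed
  then obtain v where v: "v \<in> L" "2 * (l - 2) * card (A `` {v}) < card (rich A L l \<inter> A `` {v} \<times> A `` {v})"
    by blast
  have "r - 1 \<le> card (A `` {x} \<inter> A `` {v}) + 1" if "(v, x) \<in> A" for x
    using triangles[OF that] assms(6) by (simp add: Int_commute)
  then show ?thesis using find_cycle[OF sg assms(2) v(1) assms(3-5) v(2)] by blast
qed

section \<open>Numerical estimates for the removal step\<close>

text \<open>Here \<open>X\<close> is the number of low vertices among \<open>n\<close> and
  \<open>m\<close> the number of arcs. The degree sum yields a lower bound on \<open>X\<close>.
  Substituting it and \<open>l - 1 \<le> c * r\<close>, the leading terms compare exactly by
  \<open>cond\<close>; the lower order terms are absorbed by the 1 in \<open>g * r + 1\<close>,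
  using \<open>r \<ge> 4\<close>, \<open>a \<ge> 1 / 2\<close> and
  \<open>n \<ge> 2 * b * r\<close>.\<close>

lemma many_low_vertices_estimate:
  fixes b c D e n X r l m :: real
  assumes "4 \<le> r" "1 \<le> b" "0 < c" "2 * b * r \<le> n" "2 * b + 1 / 2 \<le> D" "2 \<le> l" "l \<le> c * r + 1"
    and cond: "2 * (D - b) * c \<le> (D - 2 * b) * (b - 2 * c)"
    and m: "m \<le> 2 * b * r * n + 2" "D * r * (n - X) + b * r * X \<le> m" "0 \<le> m"
  shows "(l - 1) * m \<le> X * (b * r * (b * r + 3 - 2 * l))"
proof -
  define a g where "a = D - 2 * b" and "g = b - 2 * c"
  have a: "1 / 2 \<le> a" using assms by (simp add: a_def)
  have "0 < 2 * (D - b) * c" using assms by (intro mult_pos_pos) auto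
  then have "0 < a * g" using cond by (simp add: a_def g_def)
  then have g: "0 < g" using a by (simp add: zero_less_mult_iff)
  have gb: "g \<le> b" using assms by (simp add: g_def)
  have n: "8 \<le> n" "1 \<le> n" using assms(1,2,4) mult_mono[of 1 b 4 r] by auto
  have DX: "a * r * n - 2 \<le> (D - b) * r * X"
  proof -
    have "D * r * (n - X) + b * r * X \<le> 2 * b * r * n + 2" using m by linarith
    then show ?thesis by (simp add: a_def algebra_simps)
  qed
  have Db: "0 < D - b" using assms by linarith
  have 1: "b * r + 1 - 2 * c * r \<le> b * r + 3 - 2 * l" using assms(7) by linarith
  have br: "0 < b * r" using assms by (intro mult_pos_pos) auto
  have gr: "b * r + 1 - 2 * c * r = g * r + 1" by (simp add: g_def algebra_simps)
  have gr1: "0 < g * r + 1" using g assms(1) by (intro add_pos_pos mult_pos_pos) auto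
  have "0 \<le> a * r * n - 2"
  proof -
    have "(1 / 2) * 4 * 1 \<le> a * r * n" using a assms(1) n by (intro mult_mono) auto
    then show ?thesis by linarith
  qed
  then have X: "0 \<le> X" using DX Db assms(1)
    by (smt (verit, best) mult_pos_neg mult_pos_pos)
  have key: "c * r * (2 * b * r * n + 2) * (D - b) \<le> (a * r * n - 2) * b * (g * r + 1)"
  proof -
    have "c * r * (2 * b * r * n + 2) * (D - b) = (2 * (D - b) * c) * (r * (b * r * n + 1))"
      by (simp add: algebra_simps)
    also have "\<dots> \<le> (a * g) * (r * (b * r * n + 1))"
      using cond br n assms(1) by (intro mult_right_mono) (auto simp: a_def g_def)
    \<comment> \<open>The terms quadratic in \<open>r\<close> with factor \<open>n\<close> cancel.
      What remains to show is \<open>2 * b * (g * r + 1) \<le> a * r * (b * n - g)\<close>.\<close>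
    also have "\<dots> \<le> (a * r * n - 2) * b * (g * r + 1)"
    proof -
      have b2: "b \<le> b * r" "4 \<le> b * r" using assms(1,2) mult_mono[of 1 b 4 r] by auto
      have "4 * (2 * b * r - 1) - 4 * (b * r + 1) = 4 * (b * r) - 8" by (simp add: algebra_simps)
      then have "4 * (b * r + 1) \<le> 4 * (2 * b * r - 1)" using b2 by linarith
      also have "\<dots> \<le> r * (2 * b * r - 1)" using assms(1) b2 by (intro mult_right_mono) auto
      also have "\<dots> \<le> r * (n - 1)" using assms(1,4) by (intro mult_left_mono) auto
      finally have s1: "2 * (b * r + 1) \<le> 1 / 2 * (r * (n - 1))" by linarith
      have s2: "2 * b * (g * r + 1) \<le> 2 * b * (b * r + 1)" using gb assms(1,2) by (intro mult_left_mono) auto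
      have "b * (2 * (b * r + 1)) \<le> b * (1 / 2 * (r * (n - 1)))"
        using s1 assms(2) by (intro mult_left_mono) auto
      also have "\<dots> \<le> b * (a * (r * (n - 1)))"
        using a assms(1,2) n by (intro mult_left_mono mult_right_mono) auto
      also have "\<dots> = a * r * (b * n - b)" by (simp add: algebra_simps)
      also have "\<dots> \<le> a * r * (b * n - g)" using gb a assms(1) by (intro mult_left_mono) auto
      finally have "2 * b * (g * r + 1) \<le> a * r * (b * n - g)" using s2 by linarith
      then show ?thesis by (simp add: algebra_simps)
    qed
    finally show ?thesis .
  qed
  have "(D - b) * ((l - 1) * m) \<le> (D - b) * ((c * r) * (2 * b * r * n + 2))"
  proof (intro mult_left_mono)
    show "(l - 1) * m \<le> (c * r) * (2 * b * r * n + 2)"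
      using assms(6,7) m(1,3) by (intro mult_mono) auto
  qed (use Db in simp)
  also have "\<dots> = c * r * (2 * b * r * n + 2) * (D - b)" by simp
  also have "\<dots> \<le> (a * r * n - 2) * b * (g * r + 1)" by (rule key)
  also have "\<dots> \<le> ((D - b) * r * X) * b * (g * r + 1)"
    using DX gr1 assms(2) by (intro mult_right_mono) auto
  also have "\<dots> = (D - b) * (X * (b * r * (g * r + 1)))" by (simp add: algebra_simps)
  also have "\<dots> \<le> (D - b) * (X * (b * r * (b * r + 3 - 2 * l)))"
    using Db X br 1 gr by (intro mult_left_mono) auto
  finally show ?thesis using Db by (simp only: mult_le_cancel_left_pos)
qed


text \<open>With \<open>z = (b + 1 / 2) / c\<close>, the two sides differ by \<open>2 * ((l - c * r)
  * (n - z * r)) + ((r - l) - l * (l - c * r))\<close>. Both summands are nonnegative, the second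
  because \<open>l - c * r \<le> 1\<close> and \<open>2 * l \<le> r\<close>.\<close>

lemma removal_cost_estimate:
  fixes b c b' D l n r :: real
  assumes "0 < c" and b'_def: "b' = b + 1 - c" and D_def: "D = (b + 1 / 2) / c - c / 2"
    and n: "b * r + r / 2 \<le> c * n"
    and l: "c * r \<le> l" "l \<le> c * r + 1" "0 \<le> l" "2 * l \<le> r"
  shows "2 * (b * r) * (n - r) \<le> 2 * (b' * r) * n - 2 * l * (D * r) - 2 * (r - l) * (n - r)
    - (r - l) * (r - l - 1)"
proof -
  define z where "z = (b + 1 / 2) / c"
  have b: "b = c * z - 1 / 2" using assms(1) by (simp add: z_def)
  have D: "D = z - c / 2" by (simp add: D_def z_def)
  have "c * (z * r) \<le> c * n" using n by (simp add: b algebra_simps)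
  then have "z * r \<le> n" using assms(1) by simp
  then have 1: "0 \<le> (l - c * r) * (n - z * r)" using l(1) by simp
  have "l * (l - c * r) \<le> l * 1" using l by (intro mult_left_mono) auto
  then have 2: "0 \<le> (r - l) - l * (l - c * r)" using l(4) by linarith
  have "2 * (b' * r) * n - 2 * l * (D * r) - 2 * (r - l) * (n - r) - (r - l) * (r - l - 1)
      - 2 * (b * r) * (n - r) = 2 * ((l - c * r) * (n - z * r)) + ((r - l) - l * (l - c * r))"
    unfolding b'_def D b by (simp add: field_simps power2_eq_square)
  then show ?thesis using 1 2 by linarith
qed

text \<open>
  The threshold \<open>D r\<close> for low degree is the largest one for which a cycle on \<open>r\<close> vertices, \<open>c r\<close> of
  them low, meets few enough edges in a graph with \<open>(b + 1/2) r / c\<close> vertices. In a smaller graph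
  every cycle on \<open>r\<close> vertices does.
\<close>

lemma long_cycles_step:
  fixes b c b' D :: real and r k l :: nat
  assumes IH: "\<And>(V :: 'a set) A. sgraph V A \<Longrightarrow> V \<noteq> {} \<Longrightarrow> 2 * (b * r) * card V \<le> card A
      \<Longrightarrow> has_long_cycles A r k"
    and b: "0 \<le> b" and c: "0 < c" "c \<le> b" and l: "c * r \<le> l" "l \<le> c * r + 1" "1 \<le> l" "2 * l \<le> r" "3 \<le> r"
  defines "b' \<equiv> b + 1 - c" and "D \<equiv> (b + 1 / 2) / c - c / 2"
  assumes D: "2 * b' + 1 / 2 \<le> D"
    and cond: "l = 1 \<or> 2 * (D - b') * c \<le> (D - 2 * b') * (b' - 2 * c)"
    and sg: "sgraph V (A :: ('a \<times> 'a) set)" and "V \<noteq> {}" "2 * (b' * r) * card V \<le> card A"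
  shows "has_long_cycles A r (Suc k)"
proof (rule minimal_dense_induct[of "b' * r", OF _ _ sg assms(15,16)])
  have b': "1 \<le> b'" using c by (simp add: b'_def)
  then show "0 \<le> b' * r" by simp
  fix V :: "'a set" and A
  let ?B = "b' * r" and ?n = "real (card V)"
  assume sg: "sgraph V A" and "V \<noteq> {}" and e: "2 * ?B * ?n \<le> card A" "card A < 2 * ?B * ?n + 2"
    and tri: "\<And>x y. (x, y) \<in> A \<Longrightarrow> ?B - 1 < card (A `` {x} \<inter> A `` {y})"
    and rem: "\<And>S. S \<subseteq> V \<Longrightarrow> card (A \<inter> (V - S) \<times> (V - S)) + 2 * ?B * card S \<le> card A"
  have finV: "finite V" using sgraph_finite[OF sg] .
  have rB: "r \<le> ?B" using b' by (simp add: mult_le_cancel_right1)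
  have deg: "?B \<le> card (A `` {v})" if "v \<in> V" for v
    using rem[of "{v}"] card_restrict_ge[OF sg, of "{v}" "{v}" "real (card (A `` {v}))" 0] that by auto
  have degsum: "real (card A) = (\<Sum>v\<in>V. real (card (A `` {v})))"
    using card_eq_sum_Image[OF finV, of A] sg by (simp add: sgraph_def)
  have npos: "0 < ?n" using \<open>V \<noteq> {}\<close> finV by (simp add: card_gt_0_iff)
  \<comment> \<open>Deleting all of \<open>V\<close> bounds the number of arcs of a simple graph;
    with the density this forces more than \<open>2 * ?B\<close> vertices.\<close>
  have "card A \<le> ?n * (?n - 1)"
    using card_restrict_ge[OF sg, of V "{}" 0 "?n"] by simp
  then have "?n * (2 * ?B) \<le> ?n * (?n - 1)" using e(1) by (simp add: mult.commute)
  then have n: "2 * ?B \<le> ?n - 1" using npos by simp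
  \<comment> \<open>It suffices that deleting a cycle on exactly \<open>r\<close> vertices keeps the
    density \<open>b * r\<close>. Vertices remain, as there are more than
    \<open>2 * ?B \<ge> 2 * r\<close> of them.\<close>
  have finish: "has_long_cycles A r (Suc k)"
    if xs: "is_cyc A xs" "length xs = r"
      and le: "2 * (b * r) * (?n - r) \<le> card (A \<inter> (V - set xs) \<times> (V - set xs))" for xs
  proof (rule has_long_cycles_Suc[OF xs(1)])
    have sub: "set xs \<subseteq> V" using is_cyc_subset[OF xs(1)] sg by (simp add: sgraph_def)
    have "card (set xs) = r" using xs by (simp add: is_cyc_def distinct_card)
    then have cd: "real (card (V - set xs)) = ?n - r"
      using sub finV card_mono[OF finV sub] by (simp add: card_Diff_subset finite_subset)
    then have "V - set xs \<noteq> {}" using n rB l(5) by force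
    then show "has_long_cycles (A \<inter> (V - set xs) \<times> (V - set xs)) r k"
      using IH[OF sgraph_restrict[OF sg, of "V - set xs"]] le cd by auto
  qed (use xs in simp)
  show "has_long_cycles A r (Suc k)"
  \<comment> \<open>In the small case any cycle on \<open>r\<close> vertices may be deleted. One is
    found by counting every vertex as low and asking for a single low vertex.\<close>
  proof (cases "c * ?n \<le> b * r + r / 2")
    case True
    have "(real 1 - 1) * card A < card V * (?B * (?B - 1 - 2 * real (1 - 2)))"
    proof -
      have "0 < ?B" "0 < ?B - 1" using rB l(5) by linarith+
      from mult_pos_pos[OF npos mult_pos_pos[OF this]] show ?thesis by simp
    qed
    then obtain xs where xs: "is_cyc A xs" "length xs = r"
      using exists_cycle[OF sg order.refl, of 1 r ?B] l rB tri deg by auto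
    have sub: "set xs \<subseteq> V" using is_cyc_subset[OF xs(1)] sg by (simp add: sgraph_def)
    have "card (set xs) = r" using xs by (simp add: is_cyc_def distinct_card)
    moreover then have "real (card (V - set xs)) = ?n - r"
      using sub finV card_mono[OF finV sub] by (simp add: card_Diff_subset finite_subset)
    ultimately have "card A \<le> card (A \<inter> (V - set xs) \<times> (V - set xs)) + 2 * real r * (?n - r) + real r * (real r - 1)"
      using card_restrict_ge[OF sg sub, of "{}" 0 r] by simp
    moreover have "r * (c * ?n) \<le> r * (b * r + r / 2)" using True by (intro mult_left_mono) auto
    ultimately have "2 * (b * r) * (?n - r) \<le> card (A \<inter> (V - set xs) \<times> (V - set xs))"
      using e(1) unfolding b'_def by (simp add: algebra_simps power2_eq_square)
    then show ?thesis using finish xs by blast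
  next
    case False
    define L where "L = {v \<in> V. card (A `` {v}) \<le> D * r}"
    have LV: "L \<subseteq> V" by (auto simp: L_def)
    have cVL: "real (card (V - L)) = ?n - card L"
      using LV finV card_mono[OF finV LV] by (simp add: card_Diff_subset finite_subset)
    have "(\<Sum>v\<in>V - L. D * r) + (\<Sum>v\<in>L. ?B) \<le> (\<Sum>v\<in>V - L. real (card (A `` {v}))) + (\<Sum>v\<in>L. real (card (A `` {v})))"
      using deg LV by (intro add_mono sum_mono) (auto simp: L_def)
    also have "\<dots> = card A" unfolding degsum using sum.subset_diff[OF LV finV] by metis
    finally have DL: "D * r * (?n - card L) + ?B * card L \<le> card A"
      by (simp add: cVL algebra_simps)
    have many: "(real l - 1) * card A < card L * (?B * (?B - 1 - 2 * real (l - 2)))"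
    \<comment> \<open>For \<open>l = 1\<close> the left side is 0 and one low vertex suffices.
      Without any, the degree sum exceeds \<open>2 * ?B * ?n\<close> by at least
      \<open>r * ?n / 2 \<ge> 3\<close>, but \<open>card A\<close> exceeds it by less than
      2.\<close>
    proof (cases "l = 1")
      case True
      have "card L \<noteq> 0"
      proof
        assume "card L = 0"
        then have "D * r * ?n \<le> card A" using DL by simp
        moreover have "(2 * b' + 1 / 2) * r * ?n \<le> D * r * ?n" using D by (intro mult_right_mono) auto
        moreover have "2 \<le> ?n" using n rB l(5) by linarith
        then have "1 / 2 * 3 * 2 \<le> 1 / 2 * real r * ?n"
          using l(5) by (intro mult_mono) auto
        ultimately show False using e(2) by (simp add: algebra_simps)
      qed
      moreover have "0 < ?B" "0 < ?B - 1" using rB l(5) by linarith+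
      ultimately show ?thesis using True by simp
    next
      case False
      then have l2: "2 \<le> l" using l(3) by linarith
      let ?m = "2 * b' * r * ?n + 2"
      have "(real l - 1) * ?m \<le> real (card L) * (b' * r * (b' * r + 3 - 2 * real l))"
      proof (rule many_low_vertices_estimate)
        show "4 \<le> real r" using l2 l(4) by linarith
        show "2 * b' * r \<le> ?n" using n by simp
        show "D * r * (?n - card L) + b' * r * card L \<le> ?m" using DL e(2) by simp
        show "0 \<le> ?m" using e by (simp add: mult.assoc)
        show "2 * (D - b') * c \<le> (D - 2 * b') * (b' - 2 * c)" using cond False by blast
      qed (use b' c D l l2 in auto)
      moreover have "(real l - 1) * card A < (real l - 1) * ?m"
        using e(2) l2 by (intro mult_strict_left_mono) auto
      moreover have "?B - 1 - 2 * real (l - 2) = ?B + 3 - 2 * real l"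
        using l2 by (simp add: of_nat_diff)
      ultimately show ?thesis by (simp only:)
    qed
    obtain xs where xs: "is_cyc A xs" "length xs = r" "l \<le> card (set xs \<inter> L)"
      using exists_cycle[OF sg LV l(3-5) rB tri deg many] by blast
    \<comment> \<open>Exactly \<open>l\<close> low vertices are charged \<open>D * r\<close>;
      further low vertices of the cycle are treated as arbitrary ones.\<close>
    obtain S where S: "S \<subseteq> set xs \<inter> L" "card S = l" using xs(3) by (meson obtain_subset_with_card_n)
    have sub: "set xs \<subseteq> V" using is_cyc_subset[OF xs(1)] sg by (simp add: sgraph_def)
    have cx: "card (set xs) = r" using xs by (simp add: is_cyc_def distinct_card)
    then have c1: "real (card (V - set xs)) = ?n - r"
      using sub finV card_mono[OF finV sub] by (simp add: card_Diff_subset finite_subset)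
    have c2: "real (card (set xs - S)) = real r - l"
      using S cx l(4) finite_subset[of S "set xs"] by (simp add: card_Diff_subset)
    have "card A \<le> card (A \<inter> (V - set xs) \<times> (V - set xs)) + 2 * real l * (D * r) + 2 * (real r - l) * (?n - r) + (real r - l) * (real r - l - 1)"
      using card_restrict_ge[OF sg sub, of S "D * r" "real r - l"] S c1 c2 by (auto simp: L_def)
    moreover have "2 * (b' * r) * ?n - 2 * real l * (D * r) - 2 * (real r - l) * (?n - r) - (real r - l) * (real r - l - 1)
        \<ge> 2 * (b * r) * (?n - r)"
      using False l c by (intro removal_cost_estimate[where b = b and c = c]) (auto simp: b'_def D_def)
    ultimately have "2 * (b * r) * (?n - r) \<le> card (A \<inter> (V - set xs) \<times> (V - set xs))"
      using e(1) by linarith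
    then show ?thesis using finish xs by blast
  qed
qed

section \<open>Disjoint long cycles\<close>

text \<open>\<open>b\<close> is the number of edges per vertex in units of \<open>r\<close>. The
  argument \<open>T\<close> fixes the vertex type, so that statements for successive
  \<open>k\<close> can be chained.\<close>

definition forces_long_cycles :: "'a itself \<Rightarrow> nat \<Rightarrow> nat \<Rightarrow> real \<Rightarrow> bool" where
  "forces_long_cycles T r k b \<longleftrightarrow> (\<forall>(V :: 'a set) A. sgraph V A \<longrightarrow> V \<noteq> {}
     \<longrightarrow> 2 * (b * r) * card V \<le> card A \<longrightarrow> has_long_cycles A r k)"

lemma forces_long_cycles_mono:
  assumes "forces_long_cycles T r k b" "b \<le> b'"
  shows "forces_long_cycles T r k b'"
  unfolding forces_long_cycles_def
proof (intro allI impI)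
  fix V :: "'a set" and A
  assume sg: "sgraph V A" "V \<noteq> {}" and "2 * (b' * r) * card V \<le> card A"
  moreover have "2 * (b * r) * card V \<le> 2 * (b' * r) * card V"
    using assms(2) by (intro mult_right_mono mult_left_mono) auto
  ultimately show "has_long_cycles A r k"
    using assms(1) unfolding forces_long_cycles_def by (meson order.trans)
qed

text \<open>The number of low vertices is taken as \<open>l = \<lceil>c * r\<rceil>\<close>. The
  condition on \<open>c\<close> guarantees \<open>2 * l \<le> r\<close>, and for
  \<open>r = 3\<close> it gives \<open>l = 1\<close>.\<close>

lemma forces_long_cycles_Suc:
  fixes b c :: real
  assumes "forces_long_cycles T r k b" and "0 \<le> b" "0 < c" "c \<le> b" "3 \<le> r"
    and c: "c \<le> 2 / 5 \<and> 4 \<le> r \<or> c = 1 / 3"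
    and D: "2 * (b + 1 - c) + 1 / 2 \<le> (b + 1 / 2) / c - c / 2"
    and cond: "r = 3 \<or> 2 * ((b + 1 / 2) / c - c / 2 - (b + 1 - c)) * c
      \<le> ((b + 1 / 2) / c - c / 2 - 2 * (b + 1 - c)) * ((b + 1 - c) - 2 * c)"
  shows "forces_long_cycles T r (Suc k) (b + 1 - c)"
proof -
  define l where "l = nat \<lceil>c * r\<rceil>"
  have "0 < c * r" using assms(3,5) by simp
  then have l: "c * r \<le> l" "l < c * r + 1" "1 \<le> l" unfolding l_def by linarith+
  have lr: "2 * l \<le> r \<and> (r = 3 \<longrightarrow> l = 1)"
  proof (cases "r = 3")
    case True
    then show ?thesis using c l by auto
  next
    case False
    have "c * r \<le> 2 / 5 * r" using c by (intro mult_right_mono) auto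
    then have "5 * l < 2 * r + 5" using l(2) by linarith
    then show ?thesis using False assms(5) by presburger
  qed
  show ?thesis
    unfolding forces_long_cycles_def
  proof (intro allI impI)
    fix V :: "'a set" and A
    assume "sgraph V A" "V \<noteq> {}" "2 * ((b + 1 - c) * r) * card V \<le> card A"
    then show "has_long_cycles A r (Suc k)"
      using assms(1) l lr cond D unfolding forces_long_cycles_def
      by (intro long_cycles_step[where b = b and c = c and l = l, OF _ assms(2-4) _ _ _ _ assms(5)]) auto
  qed
qed

lemma forces_long_cycles_one:
  assumes "3 \<le> r"
  shows "forces_long_cycles T r 1 (2 / 3)"
  unfolding forces_long_cycles_def using long_cycle assms by blast

lemma forces_long_cycles:
  assumes "3 \<le> r" "6 \<le> k"
  shows "forces_long_cycles T r k (2 / 3 * real k)"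
proof (cases "r = 3")
  case True
  have "forces_long_cycles T r k (2 / 3 * real k)" if "1 \<le> k" for k
    using that
  proof (induction k rule: dec_induct)
    case base
    then show ?case using forces_long_cycles_one[OF assms(1)] by simp
  next
    case (step k)
    have "forces_long_cycles T r (Suc k) (2 / 3 * real k + 1 - 1 / 3)"
      by (rule forces_long_cycles_Suc[OF step.IH]) (use True step.hyps in \<open>auto simp: field_simps\<close>)
    moreover have "2 / 3 * real k + 1 - 1 / 3 = 2 / 3 * real (Suc k)" by simp
    ultimately show ?case by (simp only:)
  qed
  then show ?thesis using assms by simp
next
  case False
  then have r: "4 \<le> r" using assms by simp
  note Suc = forces_long_cycles_Suc[where r = r and T = T]
  \<comment> \<open>Here \<open>c\<close> is \<open>6/25\<close>, \<open>8/25\<close>, \<open>9/25\<close>, \<open>9/25\<close>, \<open>2/5\<close>, found by a numerical search.\<close>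
  have "forces_long_cycles T r 1 (17 / 25)"
    by (rule forces_long_cycles_mono[OF forces_long_cycles_one[OF assms(1)]]) simp
  \<comment> \<open>Rounding \<open>2 / 3\<close> up to \<open>17 / 25\<close> makes all values
    multiples of \<open>1 / 25\<close>; each step adds \<open>1 - c\<close>, and the last one
    reaches \<open>4 = 2 / 3 * 6\<close> exactly.\<close>
  then have "forces_long_cycles T r 2 (36 / 25)"
    using Suc[of 1 "17 / 25" "6 / 25"] r by (simp add: eval_nat_numeral)
  then have "forces_long_cycles T r 3 (53 / 25)"
    using Suc[of 2 "36 / 25" "8 / 25"] r by (simp add: eval_nat_numeral)
  then have "forces_long_cycles T r 4 (69 / 25)"
    using Suc[of 3 "53 / 25" "9 / 25"] r by (simp add: eval_nat_numeral)
  then have "forces_long_cycles T r 5 (17 / 5)"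
    using Suc[of 4 "69 / 25" "9 / 25"] r by (simp add: eval_nat_numeral)
  then have six: "forces_long_cycles T r 6 4"
    using Suc[of 5 "17 / 5" "2 / 5"] r by (simp add: eval_nat_numeral)
  show ?thesis
    using assms(2)
  proof (induction k rule: dec_induct)
    case base
    then show ?case using six by simp
  next
    case (step k)
    define b where "b = 2 / 3 * real k"
    have b: "4 \<le> b" using step.hyps by (simp add: b_def)
    \<comment> \<open>For \<open>c = 1 / 3\<close> both factors on the right of the condition equal
      \<open>b\<close>, and it reads \<open>4 / 3 * b + 4 / 9 \<le> b * b\<close>. It is used here
      multiplied by 108.\<close>
    then have "b * (4 * 108) \<le> b * (b * 108)" by (intro mult_left_mono mult_right_mono) auto
    then have "48 + b * 144 \<le> b * (b * 108)" using b by linarith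
    then have "forces_long_cycles T r (Suc k) (b + 1 - 1 / 3)"
      using b r step.IH unfolding b_def[symmetric]
      by (intro Suc) (auto simp: field_simps)
    moreover have "b + 1 - 1 / 3 = 2 / 3 * real (Suc k)" by (simp add: b_def)
    ultimately show ?case by (simp only:)
  qed
qed

section \<open>Translation from and to the graph library\<close>

text \<open>Each fibre of the map from arcs to edges contains both orientations of the edge, which
  differ because there are no loops.\<close>

lemma two_card_edges_le:
  assumes "pair_graph G"
  shows "2 * card (edges G) \<le> card (parcs G)"
proof -
  interpret pair_graph G by fact
  let ?g = "\<lambda>p. {fst p, snd p}"
  have fin: "finite (parcs G)" by (rule pair_finite_arcs)
  have im: "?g ` parcs G = edges G" by (force simp: edges_def)
  have "2 \<le> card {p \<in> parcs G. ?g p = e}" if e: "e \<in> edges G" for e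
  proof -
    obtain u v where uv: "e = {u, v}" "(u, v) \<in> parcs G" using e by (auto simp: edges_def)
    have "u \<noteq> v" "(v, u) \<in> parcs G" using uv(2) pair_no_loops arcs_symmetric by fastforce+
    then have "card {(u, v), (v, u)} = 2" "{(u, v), (v, u)} \<subseteq> {p \<in> parcs G. ?g p = e}"
      using uv by auto
    then show ?thesis using fin card_mono[of "{p \<in> parcs G. ?g p = e}" "{(u, v), (v, u)}"] by simp
  qed
  then have "(\<Sum>e\<in>edges G. 2) \<le> (\<Sum>e\<in>edges G. card {p \<in> parcs G. ?g p = e})" by (rule sum_mono)
  also have "\<dots> = (\<Sum>e\<in>edges G. \<Sum>p\<in>{p \<in> parcs G. ?g p = e}. 1)" by simp
  also have "\<dots> = (\<Sum>p\<in>parcs G. 1)"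
    by (rule sum.group[OF fin]) (simp_all add: im[symmetric] fin)
  finally show ?thesis by simp
qed

lemma pair_graph_sgraph:
  assumes "pair_graph G"
  shows "sgraph (pverts G) (parcs G)"
proof -
  interpret pair_graph G by fact
  show ?thesis
    unfolding sgraph_def sym_def irrefl_def
    using pair_finite_verts in_arcsD1 in_arcsD2 arcs_symmetric pair_no_loops by fastforce
qed

lemma pawalk_verts_conv:
  "p \<noteq> [] \<Longrightarrow> pawalk_verts u p = map fst p @ [snd (last p)]"
proof (induction p arbitrary: u)
  case (Cons e p)
  then show ?case by (cases p) auto
qed simp

lemma pcas_zip: "pcas x (zip (x # xs) (xs @ [y])) y"
  by (induction xs arbitrary: x) auto

lemma set_zip_walk: "walk A (x # xs @ [y]) \<Longrightarrow> set (zip (x # xs) (xs @ [y])) \<subseteq> A"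
  by (induction xs arbitrary: x) auto

text \<open>Pairing every vertex with its cyclic successor gives a closed walk with as many arcs as
  the cycle has vertices, so the length bound carries over.\<close>

lemma is_cyc_graph_cycle:
  assumes G: "pair_graph G" and cyc: "is_cyc (parcs G) xs"
  shows "\<exists>p. graph_cycle G p \<and> cycle_verts p = set xs"
proof -
  interpret pair_graph G by fact
  obtain x ys where xs: "xs = x # ys" using cyc by (cases xs) (auto simp: is_cyc_def)
  define p where "p = zip (x # ys) (ys @ [x])"
  have len: "length p = length xs" by (simp add: p_def xs)
  have ne: "p \<noteq> []" by (simp add: p_def)
  have "walk (parcs G) (x # ys @ [x])"
  proof -
    have "ys \<noteq> []" using cyc by (auto simp: is_cyc_def xs)
    then show ?thesis using cyc by (simp add: is_cyc_def xs successively_Cons successively_append_iff)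
  qed
  then have sub: "set p \<subseteq> parcs G" unfolding p_def by (rule set_zip_walk)
  have "map fst p = x # ys" by (simp add: p_def)
  moreover have "snd (last p) = x"
  proof -
    have "snd (last p) = last (map snd p)" using ne by (simp add: last_map)
    also have "map snd p = ys @ [x]" by (simp add: p_def)
    finally show ?thesis by simp
  qed
  ultimately have verts: "pawalk_verts u p = x # ys @ [x]" for u
    using pawalk_verts_conv[OF ne] by simp
  have "(x, hd (ys @ [x])) \<in> parcs G" using \<open>walk (parcs G) (x # ys @ [x])\<close> by (cases ys) auto
  then have "x \<in> pverts G" by (rule in_arcsD1)
  moreover have "pcas x p x" unfolding p_def by (rule pcas_zip)
  ultimately have "awalk x p x" using sub by (simp add: awalk_def)
  moreover have "distinct (tl (pawalk_verts x p))" using cyc by (auto simp: verts is_cyc_def xs)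
  ultimately have "cycle p" using ne unfolding cycle_def by auto
  moreover have "3 \<le> length p" using len cyc by (simp add: is_cyc_def)
  moreover have "cycle_verts p = set xs" unfolding cycle_verts_def verts by (auto simp: xs)
  ultimately show ?thesis unfolding graph_cycle_def by blast
qed

theorem theorem1:
  fixes G :: "'a pair_pre_digraph" and k r :: nat
  assumes "k \<ge> 6" and "r \<ge> 3"
    and "pair_graph G"
    and "average_degree G \<ge> 4 / 3 * real k * real r"
  shows "\<exists>C :: nat \<Rightarrow> ('a \<times> 'a) awalk.
           (\<forall>i<k. graph_cycle G (C i) \<and> card (cycle_verts (C i)) \<ge> r) \<and>
           disjoint_family_on (\<lambda>i. cycle_verts (C i)) {..<k}"
proof -
  have sg: "sgraph (pverts G) (parcs G)" by (rule pair_graph_sgraph[OF assms(3)])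
  have pos: "0 < 4 / 3 * real k * real r" using assms(1,2) by simp
  \<comment> \<open>Without vertices the average degree would be 0 by division by zero, below the
    positive bound.\<close>
  then have V: "pverts G \<noteq> {}" using assms(4) by (auto simp: average_degree_def)
  then have "0 < card (pverts G)" using sgraph_finite[OF sg] by (simp add: card_gt_0_iff)
  then have "4 / 3 * real k * real r * card (pverts G) \<le> 2 * real (card (edges G))"
    using assms(4) by (simp add: average_degree_def pos_le_divide_eq)
  also have "\<dots> \<le> card (parcs G)" using two_card_edges_le[OF assms(3)] by linarith
  finally have "2 * (2 / 3 * real k * real r) * card (pverts G) \<le> card (parcs G)" by simp
  then have "has_long_cycles (parcs G) r k"
    using forces_long_cycles[OF assms(2,1), of "TYPE('a)"] sg V unfolding forces_long_cycles_def by blast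
  then obtain C where C: "\<And>i. i < k \<Longrightarrow> is_cyc (parcs G) (C i) \<and> r \<le> length (C i)"
    "disjoint_family_on (\<lambda>i. set (C i)) {..<k}"
    unfolding has_long_cycles_def by blast
  have "\<forall>i<k. \<exists>p. graph_cycle G p \<and> cycle_verts p = set (C i)"
    using is_cyc_graph_cycle[OF assms(3)] C(1) by blast
  then obtain D where D: "\<And>i. i < k \<Longrightarrow> graph_cycle G (D i) \<and> cycle_verts (D i) = set (C i)"
    by metis
  have "card (cycle_verts (D i)) \<ge> r" if "i < k" for i
    using C(1)[OF that] D[OF that] by (simp add: is_cyc_def distinct_card)
  moreover have "disjoint_family_on (\<lambda>i. cycle_verts (D i)) {..<k}"
    using C(2) D by (simp add: disjoint_family_on_def)
  ultimately show ?thesis using D by blast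
qed

end
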